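(* Let $d_1,\dots,d_k\in[0,2\pi)$ be $k\ge 2$ distinct real numbers, let $y:[n]\to\{e^{\mathbf{i}d_1},\dots,e^{\mathbf{i}d_k}\}$ be the true color assignment mapping, $\mathbf{y}=(y(1),\dots,y(n))^t$, let $\sigma>0$ be deterministic (possibly depending on $n$), and let the observation be $$\mathbf{V}=\mathbf{y}\overline{\mathbf{y}}^t+\sigma\,\mathrm{diag}(\mathbf{y})\,\mathbf{W}_s\,\mathrm{diag}(\overline{\mathbf{y}}),$$ where $\mathbf{W}_s$ is the standard $n\times n$ GOE random matrix. Let $p(Y;\sigma)$ be the probability that the solution $Y$ of the optimization problem $$\max\ \Re\langle\mathbf{V},X\rangle\quad\text{subject to}\quad X_{ii}=1\ (1\le i\le n),\quad X\succeq 0$$ coincides with $\mathbf{y}\overline{\mathbf{y}}^t$. If there exists a constant $\delta>0$ independent of $n$ such that $$\sigma<\frac{(1-\delta)\sqrt{n}}{\sqrt{2\log n}},$$ then $$\lim_{n\to\infty}p(Y;\sigma)=1 .$$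
   Context: $[n]=\{1,\dots,n\}$ and $\mathbf{i}$ is the imaginary unit. $X\succeq 0$ means that $X$ is an $n\times n$ positive semi-definite (complex) Hermitian matrix. The inner product of $M_1,M_2\in\mathbb{C}^{n\times n}$ is $\langle M_1,M_2\rangle=\sum_{i,j\in[n]}M_1(i,j)\overline{M_2(i,j)}$, and $\Re$ denotes the real part. $\mathrm{diag}(\mathbf{y})$ is the diagonal matrix with diagonal $\mathbf{y}$. The standard GOE matrix $\mathbf{W}_s$ is here the random real symmetric matrix whose diagonal entries and upper triangular entries are i.i.d. standard real Gaussian random variables $\mathcal{N}(0,1)_{\mathbb{R}}$. *)

theory Defs
  imports
    "HOL-Probability.Probability"
    "Jordan_Normal_Form.Schur_Decomposition"
begin

text \<open>
  Matrices are those of Jordan_Normal_Form, whose indices start at 0: the index set $[n]$ is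
  represented by \<open>{..<n}\<close>.
\<close>

definition mat_inner :: "nat \<Rightarrow> complex mat \<Rightarrow> complex mat \<Rightarrow> complex" where
  "mat_inner n A B = (\<Sum>i<n. \<Sum>j<n. A $$ (i, j) * cnj (B $$ (i, j)))"

text \<open>For Hermitian \<open>X\<close> the quadratic form is real, so taking \<open>Re\<close> loses nothing.\<close>

definition psd_hermitian :: "nat \<Rightarrow> complex mat \<Rightarrow> bool" where
  "psd_hermitian n X \<longleftrightarrow>
     X \<in> carrier_mat n n \<and> mat_adjoint X = X \<and>
     (\<forall>v \<in> carrier_vec n. 0 \<le> Re ((X *\<^sub>v v) \<bullet>c v))"

definition sdp_feasible :: "nat \<Rightarrow> complex mat \<Rightarrow> bool" where
  "sdp_feasible n X \<longleftrightarrow> psd_hermitian n X \<and> (\<forall>i<n. X $$ (i, i) = 1)"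

definition sdp_solutions :: "nat \<Rightarrow> complex mat \<Rightarrow> complex mat set" where
  "sdp_solutions n V = {X. is_arg_max (\<lambda>X. Re (mat_inner n V X)) (sdp_feasible n) X}"

definition self_outer :: "nat \<Rightarrow> (nat \<Rightarrow> complex) \<Rightarrow> complex mat" where
  "self_outer n y = Matrix.mat n n (\<lambda>(i, j). y i * cnj (y j))"

text \<open>
  In this normalization the diagonal entries have variance 1, like the off-diagonal ones.
\<close>

definition standard_GOE :: "'a measure \<Rightarrow> nat \<Rightarrow> ('a \<Rightarrow> real mat) \<Rightarrow> bool" where
  "standard_GOE M n W \<longleftrightarrow>
     prob_space M \<and>
     (\<forall>\<omega> \<in> space M. W \<omega> \<in> carrier_mat n n \<and> (W \<omega>)\<^sup>T = W \<omega>) \<and>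
     prob_space.indep_vars M (\<lambda>_. borel) (\<lambda>(i, j) \<omega>. W \<omega> $$ (i, j)) {(i, j). i \<le> j \<and> j < n} \<and>
     (\<forall>i j. i \<le> j \<and> j < n \<longrightarrow> distributed M lborel (\<lambda>\<omega>. W \<omega> $$ (i, j)) std_normal_density)"

definition observation :: "nat \<Rightarrow> (nat \<Rightarrow> complex) \<Rightarrow> real \<Rightarrow> real mat \<Rightarrow> complex mat" where
  "observation n y \<sigma> W =
     self_outer n y +
     complex_of_real \<sigma> \<cdot>\<^sub>m (mat_diag n y * map_mat complex_of_real W * mat_diag n (\<lambda>i. cnj (y i)))"

text \<open>
  Exact recovery means that \<open>self_outer n y\<close> is the one and only maximizer.
\<close>

definition recovery_prob ::
  "'a measure \<Rightarrow> nat \<Rightarrow> (nat \<Rightarrow> complex) \<Rightarrow> real \<Rightarrow> ('a \<Rightarrow> real mat) \<Rightarrow> real" where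
  "recovery_prob M n y \<sigma> W =
     measure M {\<omega> \<in> space M. sdp_solutions n (observation n y \<sigma> (W \<omega>)) = {self_outer n y}}"

end

theory Submission
  imports Defs "HOL-Real_Asymp.Real_Asymp"
begin

text \<open>
  Conjugating by \<open>diag(y)\<close> turns the objective into a pairing with \<open>J + \<sigma> W\<close>, where \<open>J\<close> is the
  all-ones matrix. A feasible \<open>X\<close> then has real part \<open>Z = \<Sum>\<^sub>k u\<^sub>k u\<^sub>k\<^sup>T\<close> with unit diagonal, so
  \<open>1 - Z\<^sub>i\<^sub>j\<close> is half the sum of the \<open>(u\<^sub>k(i) - u\<^sub>k(j))\<^sup>2\<close>, and exact recovery follows once the
  Laplacian form \<open>\<Sum>\<^sub>i\<^sub>j (1 + \<sigma> W\<^sub>i\<^sub>j) (v\<^sub>i - v\<^sub>j)\<^sup>2\<close> is positive on nonconstant \<open>v\<close>. For \<open>v\<close> of mean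
  zero this form is at least \<open>2 (n - \<sigma> (a + b)) |v|\<^sup>2\<close>, where \<open>-a\<close> bounds the row sums of \<open>W\<close> from
  below and \<open>b\<close> bounds its quadratic form from above. The row sums are \<open>N(0, n)\<close>, so with high
  probability \<open>a\<close> is about \<open>sqrt (2 n log n)\<close>, which gives the threshold, while \<open>b = O(sqrt n)\<close>
  is of lower order.
\<close>

section \<open>Positive semidefinite matrices and the deterministic recovery criterion\<close>

text \<open>Cholesky factorization by induction on the size: eliminating the last index leaves the
  Schur complement, which is again positive semidefinite, and the eliminated rank-one part supplies
  one more Gram coordinate.\<close>

lemma real_psd_gram:
  fixes Q :: "nat \<Rightarrow> nat \<Rightarrow> real"
  assumes "\<And>i j. i < n \<Longrightarrow> j < n \<Longrightarrow> Q i j = Q j i"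
    and "\<And>v :: nat \<Rightarrow> real. 0 \<le> (\<Sum>i<n. \<Sum>j<n. Q i j * v i * v j)"
  shows "\<exists>u :: nat \<Rightarrow> nat \<Rightarrow> real. \<forall>i<n. \<forall>j<n. Q i j = (\<Sum>k<n. u k i * u k j)"
  using assms
proof (induction n arbitrary: Q)
  case 0
  show ?case by simp
next
  case (Suc n)
  define q where "q = Q n n"
  have sym: "Q n i = Q i n" if "i < n" for i
    using Suc.prems(1)[of n i] that by simp
  \<comment> \<open>The form on \<open>v\<close> extended by the entry \<open>s\<close> at position
    \<open>n\<close>. All later uses of positivity are choices of \<open>v\<close> and
    \<open>s\<close>.\<close>
  have form: "0 \<le> (\<Sum>i<n. \<Sum>j<n. Q i j * v i * v j) + 2 * s * (\<Sum>i<n. Q i n * v i) + s\<^sup>2 * q"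
    for v :: "nat \<Rightarrow> real" and s
  proof -
    have "0 \<le> (\<Sum>i<Suc n. \<Sum>j<Suc n. Q i j * (v(n := s)) i * (v(n := s)) j)"
      by (rule Suc.prems(2))
    also have "\<dots> = (\<Sum>i<n. (\<Sum>j<n. Q i j * v i * v j) + Q i n * v i * s)
        + ((\<Sum>j<n. Q n j * s * v j) + q * s * s)"
      by (simp add: q_def)
    also have "(\<Sum>j<n. Q n j * s * v j) = (\<Sum>j<n. Q j n * v j * s)"
      by (intro sum.cong) (auto simp: sym)
    also have "(\<Sum>i<n. (\<Sum>j<n. Q i j * v i * v j) + Q i n * v i * s)
        + ((\<Sum>j<n. Q j n * v j * s) + q * s * s)
        = (\<Sum>i<n. \<Sum>j<n. Q i j * v i * v j) + 2 * s * (\<Sum>i<n. Q i n * v i) + s\<^sup>2 * q"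
      by (simp add: sum.distrib sum_distrib_left power2_eq_square mult_ac)
    finally show ?thesis .
  qed
  have q0: "0 \<le> q"
    using form[of "\<lambda>_. 0" 1] by simp
  \<comment> \<open>With a zero pivot the form at the \<open>i\<close>-th unit vector is affine in
    \<open>s\<close>; a nonzero slope would let it reach the value -1.\<close>
  have last_zero: "Q i n = 0" if "q = 0" "i < n" for i
  proof (rule ccontr)
    assume nz: "Q i n \<noteq> 0"
    define v :: "nat \<Rightarrow> real" where "v = (\<lambda>j. if j = i then 1 else 0)"
    have b: "(\<Sum>j<n. Q j n * v j) = Q i n"
      using that by (simp add: v_def if_distrib cong: if_cong)
    define a where "a = (\<Sum>i<n. \<Sum>j<n. Q i j * v i * v j)"
    have "0 \<le> a + 2 * (- (a + 1) / (2 * Q i n)) * Q i n"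
      using form[of v "- (a + 1) / (2 * Q i n)"] b that by (simp add: a_def)
    then show False using nz by (simp add: field_simps)
  qed
  \<comment> \<open>The Schur complement of the last diagonal entry. For \<open>q = 0\<close> the
    quotient is 0 by convention, so \<open>Q'\<close> is then just \<open>Q\<close>.\<close>
  define Q' where "Q' = (\<lambda>i j. Q i j - Q i n * Q j n / q)"
  have "\<exists>u :: nat \<Rightarrow> nat \<Rightarrow> real. \<forall>i<n. \<forall>j<n. Q' i j = (\<Sum>k<n. u k i * u k j)"
  proof (rule Suc.IH)
    show "Q' i j = Q' j i" if "i < n" "j < n" for i j
      using Suc.prems(1)[of i j] that by (simp add: Q'_def)
    show "0 \<le> (\<Sum>i<n. \<Sum>j<n. Q' i j * v i * v j)" for v :: "nat \<Rightarrow> real"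
    proof -
      define b where "b = (\<Sum>i<n. Q i n * v i)"
      have "(\<Sum>i<n. \<Sum>j<n. Q' i j * v i * v j)
          = (\<Sum>i<n. \<Sum>j<n. Q i j * v i * v j) - (\<Sum>i<n. \<Sum>j<n. (Q i n * v i) * (Q j n * v j) / q)"
        unfolding sum_subtractf[symmetric] Q'_def
        by (intro sum.cong refl) (simp add: algebra_simps)
      also have "(\<Sum>i<n. \<Sum>j<n. (Q i n * v i) * (Q j n * v j) / q) = b\<^sup>2 / q"
        by (simp add: b_def power2_eq_square sum_product sum_divide_distrib)
      \<comment> \<open>Completing the square: \<open>s = - b / q\<close> minimizes the extended
        form when \<open>q > 0\<close>, and the minimum is the Schur complement form. For
        \<open>q = 0\<close> all quotients vanish and the identity persists.\<close>
      also have "(\<Sum>i<n. \<Sum>j<n. Q i j * v i * v j) - b\<^sup>2 / q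
          = (\<Sum>i<n. \<Sum>j<n. Q i j * v i * v j) + 2 * (- b / q) * b + (- b / q)\<^sup>2 * q"
        by (cases "q = 0") (auto simp: field_simps power2_eq_square)
      finally show ?thesis
        using form[of v "- b / q"] by (simp add: b_def)
    qed
  qed
  then obtain u :: "nat \<Rightarrow> nat \<Rightarrow> real"
    where u: "\<And>i j. i < n \<Longrightarrow> j < n \<Longrightarrow> Q' i j = (\<Sum>k<n. u k i * u k j)"
    by blast
  \<comment> \<open>The new coordinate \<open>k = n\<close> is the last column scaled by the root of
    the pivot; the old coordinates are extended by 0 at the last index.\<close>
  define u' where
    "u' = (\<lambda>k i. if k = n then Q i n / sqrt q else if i = n then 0 else u k i)"
  have "Q i j = (\<Sum>k<Suc n. u' k i * u' k j)" if ij: "i < Suc n" "j < Suc n" for i j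
  proof -
    have root: "Q i n / sqrt q * (Q j n / sqrt q) = Q i n * Q j n / q"
      using q0 by simp
    consider "i < n" "j < n" | "i = n \<or> j = n"
      using ij by linarith
    then show ?thesis
    proof cases
      case 1
      then have "(\<Sum>k<n. u' k i * u' k j) = Q' i j"
        using u by (simp add: u'_def)
      then show ?thesis
        using root by (simp add: u'_def Q'_def)
    next
      case 2
      then have "(\<Sum>k<n. u' k i * u' k j) = 0"
        by (intro sum.neutral) (auto simp: u'_def)
      moreover have "Q i n * Q j n / q = Q i j"
        using 2 ij last_zero sym q_def Suc.prems(1)[of i j]
        by (cases "q = 0") (auto simp: less_Suc_eq)
      ultimately show ?thesis
        using root by (simp add: u'_def)
    qed
  qed
  then show ?case by blast
qed

section \<open>Entrywise description of the semidefinite program\<close>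

lemma observation_index:
  assumes "W \<in> carrier_mat n n" "i < n" "j < n"
  shows "observation n y \<sigma> W $$ (i, j) = y i * cnj (y j) * of_real (1 + \<sigma> * W $$ (i, j))"
proof -
  have "mat_diag n y * map_mat complex_of_real W * mat_diag n (\<lambda>i. cnj (y i))
      = Matrix.mat n n (\<lambda>(i, j). y i * of_real (W $$ (i, j)) * cnj (y j))"
    using assms(1)
    by (subst mat_diag_mult_left[where nr = n], simp, subst mat_diag_mult_right[where nr = n]) auto
  then show ?thesis
    using assms by (simp add: observation_def self_outer_def algebra_simps)
qed

lemma quadratic_form_index:
  assumes "X \<in> carrier_mat n n"
  shows "(X *\<^sub>v vec n u) \<bullet>c vec n u = (\<Sum>i<n. \<Sum>j<n. X $$ (i, j) * u j * cnj (u i))"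
proof -
  have "(X *\<^sub>v vec n u) \<bullet>c vec n u = (\<Sum>i<n. (\<Sum>j<n. X $$ (i, j) * u j) * cnj (u i))"
    using assms by (simp add: scalar_prod_def lessThan_atLeast0)
  then show ?thesis
    by (simp add: sum_distrib_right)
qed

text \<open>Every vector of dimension \<open>n\<close> is \<open>vec n u\<close> for some function
  \<open>u\<close>, so the test vectors can range over all functions without a dimension condition.
  In this form each constraint is visibly closed in the entries.\<close>

lemma psd_hermitian_iff:
  "psd_hermitian n X \<longleftrightarrow> X \<in> carrier_mat n n \<and>
     (\<forall>i<n. \<forall>j<n. X $$ (i, j) = cnj (X $$ (j, i))) \<and>
     (\<forall>u. 0 \<le> Re (\<Sum>i<n. \<Sum>j<n. X $$ (i, j) * u j * cnj (u i)))"
    (is "_ \<longleftrightarrow> ?C \<and> ?H \<and> ?P")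
proof (cases ?C)
  case True
  have adj: "mat_adjoint X $$ (i, j) = cnj (X $$ (j, i))" if "i < n" "j < n" for i j
    using True that by (simp add: mat_adjoint_def mat_of_rows_index)
  have "mat_adjoint X = X \<longleftrightarrow> ?H"
  proof
    assume *: "mat_adjoint X = X"
    show ?H
      using adj unfolding * by blast
  next
    assume H: ?H
    show "mat_adjoint X = X"
    proof (rule eq_matI)
      fix i j assume "i < dim_row X" "j < dim_col X"
      then have ij: "i < n" "j < n" using True by auto
      show "mat_adjoint X $$ (i, j) = X $$ (i, j)"
        unfolding adj[OF ij] using H ij by metis
    qed (use True in \<open>auto simp: mat_adjoint_def\<close>)
  qed
  moreover have "(\<forall>v \<in> carrier_vec n. 0 \<le> Re ((X *\<^sub>v v) \<bullet>c v)) \<longleftrightarrow> ?P"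
  proof
    assume *: "\<forall>v \<in> carrier_vec n. 0 \<le> Re ((X *\<^sub>v v) \<bullet>c v)"
    show ?P
    proof
      fix u
      show "0 \<le> Re (\<Sum>i<n. \<Sum>j<n. X $$ (i, j) * u j * cnj (u i))"
        using *[rule_format, of "vec n u"] by (simp add: quadratic_form_index[OF True])
    qed
  next
    assume ?P
    show "\<forall>v \<in> carrier_vec n. 0 \<le> Re ((X *\<^sub>v v) \<bullet>c v)"
    proof
      fix v :: "complex vec" assume "v \<in> carrier_vec n"
      then have v: "v = vec n (\<lambda>i. v $ i)" by auto
      show "0 \<le> Re ((X *\<^sub>v v) \<bullet>c v)"
        unfolding arg_cong2[OF v v, of "\<lambda>a b. (X *\<^sub>v a) \<bullet>c b"] quadratic_form_index[OF True]
        using \<open>?P\<close> by blast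
    qed
  qed
  ultimately show ?thesis
    by (simp add: psd_hermitian_def True)
qed (simp add: psd_hermitian_def)

lemma sdp_feasibleD:
  assumes "sdp_feasible n X"
  shows "X \<in> carrier_mat n n"
    and "i < n \<Longrightarrow> X $$ (i, i) = 1"
    and "i < n \<Longrightarrow> j < n \<Longrightarrow> X $$ (i, j) = cnj (X $$ (j, i))"
    and "0 \<le> Re (\<Sum>i<n. \<Sum>j<n. X $$ (i, j) * u j * cnj (u i))"
  using assms unfolding sdp_feasible_def psd_hermitian_iff by blast+

text \<open>The principal 2 by 2 block with unit diagonal is positive semidefinite. The bound makes
  the feasible set compact, and it forces an entry with real part 1 to equal 1 after
  conjugation.\<close>

lemma sdp_feasible_norm_le_1:
  assumes X: "sdp_feasible n X" and "i < n" "j < n"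
  shows "norm (X $$ (i, j)) \<le> 1"
proof (cases "i = j \<or> X $$ (i, j) = 0")
  case True
  then show ?thesis using assms sdp_feasibleD(2)[OF X] by auto
next
  case False
  define x where "x = X $$ (i, j)"
  have herm: "X $$ (j, i) = cnj x" and diag: "X $$ (i, i) = 1" "X $$ (j, j) = 1"
    using sdp_feasibleD(2,3)[OF X] assms(2,3) unfolding x_def by blast+
  define r where "r = complex_of_real (norm x)"
  \<comment> \<open>The phase with \<open>x * \<beta> = - r\<close>: the test vector with entries 1
    at \<open>i\<close> and \<open>\<beta>\<close> at \<open>j\<close> gives the form the value
    \<open>2 - 2 * r\<close>.\<close>
  define \<beta> where "\<beta> = - cnj x / r"
  define u where "u a = (if a = i then 1 else 0) + (if a = j then \<beta> else 0)" for a
  have r: "r \<noteq> 0" "x * cnj x = r * r" "cnj \<beta> = - x / r"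
    using False by (auto simp: x_def r_def \<beta>_def power2_eq_square simp flip: complex_norm_square)
  have delta: "(\<Sum>a<n. f a * u a) = f i + f j * \<beta>" for f :: "nat \<Rightarrow> complex"
  proof -
    have "(\<Sum>a<n. f a * u a)
        = (\<Sum>a<n. (if a = i then f a else 0) + (if a = j then f a * \<beta> else 0))"
      by (intro sum.cong refl) (simp add: u_def algebra_simps)
    then show ?thesis using assms(2,3) by (simp add: sum.distrib)
  qed
  have delta': "(\<Sum>a<n. f a * cnj (u a)) = f i + f j * cnj \<beta>" for f :: "nat \<Rightarrow> complex"
  proof -
    have "(\<Sum>a<n. f a * cnj (u a))
        = (\<Sum>a<n. (if a = i then f a else 0) + (if a = j then f a * cnj \<beta> else 0))"
      by (intro sum.cong refl) (simp add: u_def algebra_simps)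
    then show ?thesis using assms(2,3) by (simp add: sum.distrib)
  qed
  have "(\<Sum>a<n. \<Sum>b<n. X $$ (a, b) * u b * cnj (u a))
      = (\<Sum>a<n. (X $$ (a, i) + X $$ (a, j) * \<beta>) * cnj (u a))"
    by (simp add: sum_distrib_right[symmetric] delta)
  also have "\<dots> = 1 + x * \<beta> + (cnj x + \<beta>) * cnj \<beta>"
    by (simp add: delta' herm diag x_def)
  also have "x * \<beta> = - (x * cnj x) / r"
    by (simp add: \<beta>_def)
  also have "(cnj x + \<beta>) * cnj \<beta> = - (x * cnj x) / r + (x * cnj x) / (r * r)"
    unfolding r(3) using r(1) by (simp add: \<beta>_def algebra_simps)
  finally have "(\<Sum>a<n. \<Sum>b<n. X $$ (a, b) * u b * cnj (u a)) = 2 - 2 * r"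
    using r(1) unfolding r(2) by simp
  then have "0 \<le> 2 - 2 * norm x"
    using sdp_feasibleD(4)[OF X, of u] by (simp add: r_def)
  then show ?thesis by (simp add: x_def)
qed

lemma sdp_feasible_self_outer:
  assumes y: "\<And>i. i < n \<Longrightarrow> norm (y i) = 1"
  shows "sdp_feasible n (self_outer n y)"
proof -
  have "0 \<le> Re (\<Sum>i<n. \<Sum>j<n. self_outer n y $$ (i, j) * u j * cnj (u i))" for u
  proof -
    define s where "s = (\<Sum>i<n. y i * cnj (u i))"
    have "(\<Sum>i<n. \<Sum>j<n. self_outer n y $$ (i, j) * u j * cnj (u i)) = s * cnj s"
      unfolding s_def cnj_sum sum_product
      by (intro sum.cong refl) (simp add: self_outer_def mult_ac)
    then show ?thesis by (simp add: complex_mult_cnj)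
  qed
  moreover have "self_outer n y $$ (i, i) = 1" if "i < n" for i
    using y[OF that] that by (simp add: self_outer_def flip: complex_norm_square)
  ultimately show ?thesis
    unfolding sdp_feasible_def psd_hermitian_iff by (simp add: self_outer_def)
qed

text \<open>Turns exact recovery into strict inequalities over the feasible set, the form needed
  both for the deterministic criterion and for measurability.\<close>

lemma sdp_solutions_eq_singleton_iff:
  "sdp_solutions n V = {Y} \<longleftrightarrow> sdp_feasible n Y \<and>
     (\<forall>X. sdp_feasible n X \<longrightarrow> X \<noteq> Y \<longrightarrow> Re (mat_inner n V X) < Re (mat_inner n V Y))"
  (is "_ \<longleftrightarrow> ?R")
proof
  assume *: "sdp_solutions n V = {Y}"
  then have Y: "is_arg_max (\<lambda>X. Re (mat_inner n V X)) (sdp_feasible n) Y"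
    by (auto simp: sdp_solutions_def)
  have "Re (mat_inner n V X) < Re (mat_inner n V Y)" if "sdp_feasible n X" "X \<noteq> Y" for X
  proof (rule ccontr)
    assume "\<not> Re (mat_inner n V X) < Re (mat_inner n V Y)"
    then have "X \<in> sdp_solutions n V"
      using Y that unfolding sdp_solutions_def is_arg_max_linorder by force
    then show False using * that by simp
  qed
  then show ?R using Y by (auto simp: is_arg_max_linorder)
next
  assume R: ?R
  show "sdp_solutions n V = {Y}"
  proof (rule Set.set_eqI)
    fix X
    show "X \<in> sdp_solutions n V \<longleftrightarrow> X \<in> {Y}"
      using R unfolding sdp_solutions_def is_arg_max_linorder by (force intro: less_imp_le)
  qed
qed

text \<open>The objective lost by moving from \<open>self_outer n y\<close> to \<open>X\<close> is
  half the sum of the Laplacian forms of the Gram coordinates of \<open>X\<close>. None of these is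
  negative, and \<open>X \<noteq> self_outer n y\<close> makes at least one coordinate nonconstant,
  hence its form positive.\<close>

lemma sdp_solutions_observation:
  fixes W :: "real mat"
  assumes y: "\<And>i. i < n \<Longrightarrow> norm (y i) = 1"
    and W: "W \<in> carrier_mat n n"
    and pos: "\<And>v i j. i < n \<Longrightarrow> j < n \<Longrightarrow> v i \<noteq> v j \<Longrightarrow>
      0 < (\<Sum>i<n. \<Sum>j<n. (1 + \<sigma> * W $$ (i, j)) * (v i - v j)\<^sup>2)"
  shows "sdp_solutions n (observation n y \<sigma> W) = {self_outer n y}"
  unfolding sdp_solutions_eq_singleton_iff
proof (intro conjI allI impI)
  show "sdp_feasible n (self_outer n y)"
    using y by (rule sdp_feasible_self_outer)
  fix X assume X: "sdp_feasible n X" and ne: "X \<noteq> self_outer n y"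
  have C: "X \<in> carrier_mat n n" and diag: "\<And>i. i < n \<Longrightarrow> X $$ (i, i) = 1"
    and herm: "\<And>i j. i < n \<Longrightarrow> j < n \<Longrightarrow> X $$ (i, j) = cnj (X $$ (j, i))"
    and psd: "\<And>u. 0 \<le> Re (\<Sum>i<n. \<Sum>j<n. X $$ (i, j) * u j * cnj (u i))"
    using sdp_feasibleD[OF X] by blast+
  have yy: "cnj (y i) * y i = 1" "y i * cnj (y i) = 1" if "i < n" for i
    using y[OF that] by (simp_all add: mult.commute flip: complex_norm_square)
  \<comment> \<open>Conjugation by the inverse of \<open>diag(y)\<close>: the target becomes the
    all-ones matrix and the observation becomes the real matrix with entries
    \<open>1 + \<sigma> * W $$ (i, j)\<close>.\<close>
  define K where "K i j = cnj (y i) * X $$ (i, j) * y j" for i j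
  have K_norm: "norm (K i j) \<le> 1" if "i < n" "j < n" for i j
    using sdp_feasible_norm_le_1[OF X that] y that by (simp add: K_def norm_mult)
  have X_K: "X $$ (i, j) = y i * K i j * cnj (y j)" if "i < n" "j < n" for i j
  proof -
    have "y i * K i j * cnj (y j) = (y i * cnj (y i)) * X $$ (i, j) * (y j * cnj (y j))"
      by (simp add: K_def mult_ac)
    then show ?thesis using yy that by simp
  qed
  \<comment> \<open>As the weights are real, only \<open>Re (K i j)\<close> enters the objective. It
    is symmetric because \<open>X\<close> is Hermitian, and positive semidefinite on real
    \<open>v\<close> by testing \<open>X\<close> on the vector \<open>y i * v i\<close>.\<close>
  obtain u :: "nat \<Rightarrow> nat \<Rightarrow> real"
    where u: "\<And>i j. i < n \<Longrightarrow> j < n \<Longrightarrow> Re (K i j) = (\<Sum>k<n. u k i * u k j)"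
  proof -
    have "\<exists>u :: nat \<Rightarrow> nat \<Rightarrow> real. \<forall>i<n. \<forall>j<n. Re (K i j) = (\<Sum>k<n. u k i * u k j)"
    proof (rule real_psd_gram)
      show "Re (K i j) = Re (K j i)" if "i < n" "j < n" for i j
      proof -
        have "K i j = cnj (K j i)"
          by (simp add: K_def herm[OF that] mult_ac)
        then show ?thesis by simp
      qed
      show "0 \<le> (\<Sum>i<n. \<Sum>j<n. Re (K i j) * v i * v j)" for v
      proof -
        have "Re (X $$ (i, j) * (y j * of_real (v j)) * cnj (y i * of_real (v i)))
            = Re (K i j) * v i * v j" for i j
        proof -
          have "X $$ (i, j) * (y j * of_real (v j)) * cnj (y i * of_real (v i))
              = K i j * of_real (v i * v j)"
            by (simp add: K_def mult_ac)
          moreover have "Re (K i j * of_real (v i * v j)) = Re (K i j) * v i * v j"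
            by (simp del: of_real_mult)
          ultimately show ?thesis by (simp only:)
        qed
        then show ?thesis
          using psd[of "\<lambda>i. y i * of_real (v i)"] by (simp only: Re_sum)
      qed
    qed
    then show ?thesis using that by blast
  qed
  have K_diff: "1 - Re (K i j) = (\<Sum>k<n. (u k i - u k j)\<^sup>2) / 2" if "i < n" "j < n" for i j
  proof -
    have d: "(\<Sum>k<n. (u k i)\<^sup>2) = 1" if "i < n" for i
      using u[OF that that] diag[OF that] yy[OF that] by (simp add: K_def power2_eq_square)
    have "(\<Sum>k<n. (u k i - u k j)\<^sup>2)
        = (\<Sum>k<n. (u k i)\<^sup>2) + (\<Sum>k<n. (u k j)\<^sup>2) - 2 * (\<Sum>k<n. u k i * u k j)"
      by (simp add: power2_diff sum_subtractf sum.distrib sum_distrib_left mult_ac)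
    then show ?thesis using d that u by simp
  qed
  define g where "g k = (\<Sum>i<n. \<Sum>j<n. (1 + \<sigma> * W $$ (i, j)) * (u k i - u k j)\<^sup>2)" for k
  have g_nonneg: "0 \<le> g k" for k
  proof (cases "\<exists>i<n. \<exists>j<n. u k i \<noteq> u k j")
    case True
    then show ?thesis using pos[of _ _ "u k"] unfolding g_def by (meson less_imp_le)
  next
    case False
    have "(1 + \<sigma> * W $$ (i, j)) * (u k i - u k j)\<^sup>2 = 0" if "i \<in> {..<n}" "j \<in> {..<n}" for i j
    proof -
      have "u k i = u k j" using False that by blast
      then show ?thesis by simp
    qed
    then have "g k = 0"
      unfolding g_def by (intro sum.neutral ballI)
    then show ?thesis by simp
  qed
  \<comment> \<open>If all real parts were 1, the entry bound would leave no room for imaginary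
    parts, so \<open>K\<close> would be the all-ones matrix and \<open>X\<close> the target.\<close>
  have "\<exists>i<n. \<exists>j<n. Re (K i j) \<noteq> 1"
  proof (rule ccontr)
    assume "\<not> ?thesis"
    then have re: "Re (K i j) = 1" if "i < n" "j < n" for i j using that by blast
    have K1: "K i j = 1" if "i < n" "j < n" for i j
    proof -
      have "(Re (K i j))\<^sup>2 + (Im (K i j))\<^sup>2 \<le> 1"
        using K_norm[OF that] by (simp flip: cmod_power2 add: power_le_one_iff)
      then show ?thesis using re[OF that] by (simp add: complex_eq_iff)
    qed
    have "X = self_outer n y"
      using C by (intro eq_matI) (auto simp: self_outer_def X_K K1)
    then show False using ne by simp
  qed
  then obtain i j where ij: "i < n" "j < n" "Re (K i j) \<noteq> 1" by blast
  have "\<exists>k<n. u k i \<noteq> u k j"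
  proof (rule ccontr)
    assume "\<not> ?thesis"
    then have "(\<Sum>k<n. (u k i - u k j)\<^sup>2) = 0"
      by (intro sum.neutral ballI) simp
    then show False using K_diff[OF ij(1,2)] ij(3) by simp
  qed
  then obtain k where k: "k < n" "u k i \<noteq> u k j" by blast
  have "0 < (\<Sum>k<n. g k)"
    using k g_nonneg pos[of i j "u k"] ij by (intro sum_pos2[of _ k]) (auto simp: g_def)
  also have "(\<Sum>k<n. g k) = (\<Sum>i<n. \<Sum>j<n. \<Sum>k<n. (1 + \<sigma> * W $$ (i, j)) * (u k i - u k j)\<^sup>2)"
    unfolding g_def by (rule trans[OF sum.swap], rule sum.cong[OF refl], rule sum.swap)
  also have "\<dots> = (\<Sum>i<n. \<Sum>j<n. 2 * ((1 + \<sigma> * W $$ (i, j)) * (1 - Re (K i j))))"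
    by (intro sum.cong refl) (simp add: K_diff flip: sum_distrib_left)
  also have "\<dots> = 2 * (\<Sum>i<n. \<Sum>j<n. (1 + \<sigma> * W $$ (i, j)) * (1 - Re (K i j)))"
    by (simp add: sum_distrib_left)
  also have "(\<Sum>i<n. \<Sum>j<n. (1 + \<sigma> * W $$ (i, j)) * (1 - Re (K i j)))
      = Re (mat_inner n (observation n y \<sigma> W) (self_outer n y))
        - Re (mat_inner n (observation n y \<sigma> W) X)"
  proof -
    have "observation n y \<sigma> W $$ (i, j) * cnj (self_outer n y $$ (i, j))
        - observation n y \<sigma> W $$ (i, j) * cnj (X $$ (i, j))
        = of_real (1 + \<sigma> * W $$ (i, j)) * (1 - cnj (K i j))" if "i < n" "j < n" for i j
    proof -
      have "observation n y \<sigma> W $$ (i, j) * cnj (self_outer n y $$ (i, j))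
          = of_real (1 + \<sigma> * W $$ (i, j)) * ((y i * cnj (y i)) * (y j * cnj (y j)))"
        unfolding observation_index[OF W that] using that by (simp add: self_outer_def mult_ac)
      moreover have "observation n y \<sigma> W $$ (i, j) * cnj (X $$ (i, j))
          = of_real (1 + \<sigma> * W $$ (i, j)) * cnj (K i j)"
        unfolding observation_index[OF W that] by (simp add: K_def mult_ac)
      ultimately show ?thesis
        using that by (simp add: yy algebra_simps)
    qed
    then have "mat_inner n (observation n y \<sigma> W) (self_outer n y)
        - mat_inner n (observation n y \<sigma> W) X
        = (\<Sum>i<n. \<Sum>j<n. of_real (1 + \<sigma> * W $$ (i, j)) * (1 - cnj (K i j)))"
      unfolding mat_inner_def sum_subtractf[symmetric] by (intro sum.cong refl) simp
    then show ?thesis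
      by (simp only: minus_complex.sel(1)[symmetric]) simp
  qed
  finally show "Re (mat_inner n (observation n y \<sigma> W) X)
      < Re (mat_inner n (observation n y \<sigma> W) (self_outer n y))"
    by simp
qed

section \<open>Measurability of the recovery event\<close>

text \<open>A positive continuous function on a compact set has a positive minimum, hence a lower
  bound \<open>1 / real (Suc m)\<close>; by continuity this bound needs testing only on a countable
  dense subset. The uncountable quantifier thus becomes countable set operations.\<close>

lemma sets_forall_compact_pos:
  fixes g :: "'a \<Rightarrow> 'b :: {metric_space, second_countable_topology} \<Rightarrow> real"
  assumes K: "compact K"
    and meas: "\<And>x. x \<in> K \<Longrightarrow> (\<lambda>\<omega>. g \<omega> x) \<in> borel_measurable M"
    and cont: "\<And>\<omega>. \<omega> \<in> space M \<Longrightarrow> continuous_on K (g \<omega>)"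
  shows "{\<omega> \<in> space M. \<forall>x\<in>K. 0 < g \<omega> x} \<in> sets M"
proof -
  obtain T where T: "countable T" "T \<subseteq> K" "K \<subseteq> closure T"
    by (rule separable)
  have "(\<forall>x\<in>K. 0 < g \<omega> x) \<longleftrightarrow> (\<exists>m. \<forall>x\<in>T. 1 / real (Suc m) \<le> g \<omega> x)"
    if \<omega>: "\<omega> \<in> space M" for \<omega>
  proof
    assume pos: "\<forall>x\<in>K. 0 < g \<omega> x"
    show "\<exists>m. \<forall>x\<in>T. 1 / real (Suc m) \<le> g \<omega> x"
    proof (cases "K = {}")
      case False
      then obtain x0 where x0: "x0 \<in> K" "\<And>x. x \<in> K \<Longrightarrow> g \<omega> x0 \<le> g \<omega> x"
        using continuous_attains_inf[OF K _ cont[OF \<omega>]] by blast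
      obtain m where "1 / real (Suc m) < g \<omega> x0"
        using pos x0(1) reals_Archimedean[of "g \<omega> x0"] by (auto simp: inverse_eq_divide)
      then show ?thesis using x0(2) T(2) by (meson less_imp_le order_trans subsetD)
    qed (use T in auto)
  next
    assume "\<exists>m. \<forall>x\<in>T. 1 / real (Suc m) \<le> g \<omega> x"
    then obtain m where m: "\<And>x. x \<in> T \<Longrightarrow> 1 / real (Suc m) \<le> g \<omega> x" by blast
    have "closed {x \<in> K. 1 / real (Suc m) \<le> g \<omega> x}"
      using cont[OF \<omega>] compact_imp_closed[OF K]
      by (intro continuous_on_closed_Collect_le continuous_on_const) auto
    then have "closure T \<subseteq> {x \<in> K. 1 / real (Suc m) \<le> g \<omega> x}"
      using m T(2) by (intro closure_minimal) auto
    then show "\<forall>x\<in>K. 0 < g \<omega> x"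
      using T(3) by (force intro: less_le_trans[of 0 "1 / real (Suc m)"])
  qed
  then have "{\<omega> \<in> space M. \<forall>x\<in>K. 0 < g \<omega> x}
      = {\<omega> \<in> space M. \<exists>m. \<forall>x\<in>T. 1 / real (Suc m) \<le> g \<omega> x}"
    by blast
  also have "\<dots> \<in> sets M"
  proof (rule sets.sets_Collect_countable_Ex)
    fix m
    have "{\<omega> \<in> space M. g \<omega> x < 1 / real (Suc m)} \<in> sets M" if "x \<in> T" for x
      using T(2) that meas by (intro borel_measurable_less) auto
    then have "space M - (\<Union>x\<in>T. {\<omega> \<in> space M. g \<omega> x < 1 / real (Suc m)}) \<in> sets M"
      using T(1) by (intro sets.compl_sets sets.countable_UN'') auto
    also have "space M - (\<Union>x\<in>T. {\<omega> \<in> space M. g \<omega> x < 1 / real (Suc m)})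
        = {\<omega> \<in> space M. \<forall>x\<in>T. 1 / real (Suc m) \<le> g \<omega> x}"
      by (auto simp: not_less)
    finally show "{\<omega> \<in> space M. \<forall>x\<in>T. 1 / real (Suc m) \<le> g \<omega> x} \<in> sets M" .
  qed
  finally show ?thesis .
qed

text \<open>Removing \<open>a\<close> destroys compactness, but the rest is the countable union of
  the compact sets of points at distance at least \<open>1 / real (Suc m)\<close> from
  \<open>a\<close>. In the application \<open>a\<close> is the true solution, where the objective
  gap is 0.\<close>

lemma sets_forall_compact_minus_pos:
  fixes g :: "'a \<Rightarrow> 'b :: {metric_space, second_countable_topology} \<Rightarrow> real"
  assumes K: "compact K"
    and meas: "\<And>x. x \<in> K \<Longrightarrow> (\<lambda>\<omega>. g \<omega> x) \<in> borel_measurable M"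
    and cont: "\<And>\<omega>. \<omega> \<in> space M \<Longrightarrow> continuous_on K (g \<omega>)"
  shows "{\<omega> \<in> space M. \<forall>x\<in>K - {a}. 0 < g \<omega> x} \<in> sets M"
proof -
  define L where "L m = K \<inter> {x. 1 / real (Suc m) \<le> dist x a}" for m
  have "compact (L m)" for m
    unfolding L_def using K by (intro compact_Int_closed closed_Collect_le continuous_intros)
  then have "{\<omega> \<in> space M. \<forall>x\<in>L m. 0 < g \<omega> x} \<in> sets M" for m
    using meas cont by (intro sets_forall_compact_pos) (auto simp: L_def intro: continuous_on_subset)
  moreover have "K - {a} = (\<Union>m. L m)"
  proof -
    have "\<exists>m. 1 / real (Suc m) \<le> dist x a" if "x \<noteq> a" for x
      using that reals_Archimedean[of "dist x a"] by (auto simp: inverse_eq_divide intro: less_imp_le)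
    then show ?thesis by (auto simp: L_def)
  qed
  then have "{\<omega> \<in> space M. \<forall>x\<in>K - {a}. 0 < g \<omega> x}
      = {\<omega> \<in> space M. \<forall>m. \<forall>x\<in>L m. 0 < g \<omega> x}"
    by auto
  ultimately show ?thesis
    by (simp add: sets.sets_Collect_countable_All)
qed

text \<open>Feasible matrices encoded as functions on index pairs, to which the product topology
  applies. The value 0 outside the index square makes the encoding unique.\<close>

definition feasible_entries :: "nat \<Rightarrow> (nat \<times> nat \<Rightarrow> complex) set" where
  "feasible_entries n =
     {c. (\<forall>p. p \<notin> {..<n} \<times> {..<n} \<longrightarrow> c p = 0) \<and> sdp_feasible n (Matrix.mat n n c)}"

text \<open>By the entry bound this is a closed subset of a product of closed unit discs, which is
  compact by Tychonoff. Closedness holds because every constraint is built from continuous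
  coordinate evaluations.\<close>

lemma compact_feasible_entries: "compact (feasible_entries n)"
proof -
  have *: "feasible_entries n = {c. (\<forall>p. c p \<in> cball 0 1)} \<inter>
      ({c. \<forall>p. p \<notin> {..<n} \<times> {..<n} \<longrightarrow> c p = 0} \<inter> {c. \<forall>i. i < n \<longrightarrow> c (i, i) = 1} \<inter>
       {c. \<forall>i. i < n \<longrightarrow> (\<forall>j. j < n \<longrightarrow> c (i, j) = cnj (c (j, i)))} \<inter>
       {c. \<forall>u. 0 \<le> Re (\<Sum>i<n. \<Sum>j<n. c (i, j) * u j * cnj (u i))})"
  proof -
    have "norm (c p) \<le> 1" if "c \<in> feasible_entries n" for c p
    proof (cases "p \<in> {..<n} \<times> {..<n}")
      case True
      then show ?thesis
        using that sdp_feasible_norm_le_1[of n "Matrix.mat n n c" "fst p" "snd p"]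
        by (auto simp: feasible_entries_def)
    next
      case False
      then have "c p = 0" using that unfolding feasible_entries_def by blast
      then show ?thesis by simp
    qed
    then show ?thesis
      by (auto simp: feasible_entries_def sdp_feasible_def psd_hermitian_iff)
  qed
  have "compactin (product_topology (\<lambda>_. euclidean) UNIV)
      (\<Pi>\<^sub>E p\<in>(UNIV :: (nat \<times> nat) set). cball (0 :: complex) 1)"
    unfolding compactin_PiE by simp
  then have "compact {c :: nat \<times> nat \<Rightarrow> complex. \<forall>p. c p \<in> cball 0 1}"
    by (simp add: euclidean_product_topology PiE_UNIV_domain Pi_def)
  moreover have coord: "continuous_on UNIV (\<lambda>c :: nat \<times> nat \<Rightarrow> complex. c p)" for p
    by simp
  ultimately show ?thesis
    unfolding *
    by (intro compact_Int_closed closed_Int closed_Collect_all closed_Collect_imp closed_Collect_eq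
        closed_Collect_le continuous_intros open_Collect_const coord)
qed

text \<open>The event compares the target with uncountably many competitors. The gap
  \<open>g\<close> is continuous in the competitor and, for a fixed one, affine in the finitely many
  entries of \<open>W \<omega>\<close>, so the compactness criterion applies.\<close>

lemma sets_recovery:
  fixes W :: "'a \<Rightarrow> real mat"
  assumes y: "\<And>i. i < n \<Longrightarrow> norm (y i) = 1"
    and W: "\<And>\<omega>. \<omega> \<in> space M \<Longrightarrow> W \<omega> \<in> carrier_mat n n"
    and meas: "\<And>i j. i < n \<Longrightarrow> j < n \<Longrightarrow> (\<lambda>\<omega>. W \<omega> $$ (i, j)) \<in> borel_measurable M"
  shows "{\<omega> \<in> space M. sdp_solutions n (observation n y \<sigma> (W \<omega>)) = {self_outer n y}} \<in> sets M"
proof -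
  define a where "a = (\<lambda>(i, j). if i < n \<and> j < n then y i * cnj (y j) else 0)"
  define g where "g \<omega> c = Re (mat_inner n (observation n y \<sigma> (W \<omega>)) (self_outer n y))
      - Re (mat_inner n (observation n y \<sigma> (W \<omega>)) (Matrix.mat n n c))" for \<omega> c
  have mat_a: "Matrix.mat n n a = self_outer n y"
    by (auto simp: a_def self_outer_def)
  have mat_eq: "Matrix.mat n n c = self_outer n y \<longleftrightarrow> c = a" if "c \<in> feasible_entries n" for c
  proof
    assume eq: "Matrix.mat n n c = self_outer n y"
    have "c (i, j) = a (i, j)" for i j
    proof (cases "i < n \<and> j < n")
      case True
      then have "Matrix.mat n n c $$ (i, j) = self_outer n y $$ (i, j)" by (simp add: eq)
      then show ?thesis using True by (simp add: a_def self_outer_def)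
    next
      case False
      then show ?thesis using that by (auto simp: feasible_entries_def a_def)
    qed
    then show "c = a" by auto
  qed (simp add: mat_a)
  have feasible: "\<exists>c\<in>feasible_entries n. X = Matrix.mat n n c" if "sdp_feasible n X" for X
  proof -
    have C: "X \<in> carrier_mat n n" using that by (simp add: sdp_feasible_def psd_hermitian_def)
    define c where "c = (\<lambda>(i, j). if i < n \<and> j < n then X $$ (i, j) else 0)"
    have "X = Matrix.mat n n c" using C by (auto simp: c_def)
    then show ?thesis
      using that by (intro bexI[of _ c]) (auto simp: feasible_entries_def c_def)
  qed
  have "(\<forall>X. sdp_feasible n X \<longrightarrow> X \<noteq> self_outer n y \<longrightarrow> P X)
      \<longleftrightarrow> (\<forall>c\<in>feasible_entries n - {a}. P (Matrix.mat n n c))" for P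
  proof (intro iffI ballI allI impI)
    fix c assume "\<forall>X. sdp_feasible n X \<longrightarrow> X \<noteq> self_outer n y \<longrightarrow> P X" "c \<in> feasible_entries n - {a}"
    then show "P (Matrix.mat n n c)" using mat_eq[of c] by (auto simp: feasible_entries_def)
  next
    fix X assume *: "\<forall>c\<in>feasible_entries n - {a}. P (Matrix.mat n n c)"
      and X: "sdp_feasible n X" "X \<noteq> self_outer n y"
    obtain c where "c \<in> feasible_entries n" "X = Matrix.mat n n c" using feasible[OF X(1)] by blast
    then show "P X" using * X mat_eq by auto
  qed
  then have "{\<omega> \<in> space M. sdp_solutions n (observation n y \<sigma> (W \<omega>)) = {self_outer n y}}
      = {\<omega> \<in> space M. \<forall>c\<in>feasible_entries n - {a}. 0 < g \<omega> c}"
    using sdp_feasible_self_outer[OF y] by (simp add: sdp_solutions_eq_singleton_iff g_def)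
  also have "\<dots> \<in> sets M"
  proof (rule sets_forall_compact_minus_pos[OF compact_feasible_entries])
    fix c
    have g: "g \<omega> c = (\<Sum>i<n. \<Sum>j<n. (1 + \<sigma> * W \<omega> $$ (i, j)) *
        Re (y i * cnj (y j) * cnj (a (i, j)) - y i * cnj (y j) * cnj (c (i, j))))"
      if "\<omega> \<in> space M" for \<omega>
      unfolding g_def mat_inner_def Re_sum sum_subtractf[symmetric]
      by (intro sum.cong refl)
        (simp add: observation_index[OF W[OF that]] a_def self_outer_def algebra_simps)
    have "(\<lambda>\<omega>. \<Sum>i<n. \<Sum>j<n. (1 + \<sigma> * W \<omega> $$ (i, j)) *
        Re (y i * cnj (y j) * cnj (a (i, j)) - y i * cnj (y j) * cnj (c (i, j)))) \<in> borel_measurable M"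
      using meas by (intro borel_measurable_sum borel_measurable_times borel_measurable_add) auto
    then show "(\<lambda>\<omega>. g \<omega> c) \<in> borel_measurable M"
      using g by (simp cong: measurable_cong)
  next
    fix \<omega>
    have "g \<omega> = (\<lambda>c. Re (mat_inner n (observation n y \<sigma> (W \<omega>)) (self_outer n y))
      - Re (\<Sum>i<n. \<Sum>j<n. observation n y \<sigma> (W \<omega>) $$ (i, j) * cnj (c (i, j))))"
      by (simp add: g_def mat_inner_def fun_eq_iff)
    moreover have "continuous_on (feasible_entries n) (\<lambda>c. c p)" for p
      by (rule continuous_on_subset[of UNIV]) auto
    ultimately show "continuous_on (feasible_entries n) (g \<omega>)"
      by (auto intro!: continuous_intros)
  qed
  finally show ?thesis .
qed

section \<open>Gaussian tail bounds\<close>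

text \<open>Completing the square: tilting the standard density by \<open>exp (s * x)\<close> gives
  \<open>exp (s\<^sup>2 / 2)\<close> times the normal density with mean \<open>s\<close> and
  variance 1.\<close>

lemma (in prob_space) std_normal_mgf:
  assumes X: "distributed M lborel X std_normal_density"
  shows "integrable M (\<lambda>\<omega>. exp (s * X \<omega>))" (is ?int)
    and "expectation (\<lambda>\<omega>. exp (s * X \<omega>)) = exp (s\<^sup>2 / 2)" (is ?eq)
proof -
  have dens: "std_normal_density x * exp (s * x) = exp (s\<^sup>2 / 2) * normal_density s 1 x" for x
    by (simp add: normal_density_def mult_exp_exp power2_eq_square field_simps)
  have meas: "(\<lambda>x. exp (s * x)) \<in> borel_measurable lborel" by simp
  show ?int
    using distributed_integrable[OF X meas] by (simp add: dens)
  show ?eq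
    using distributed_integral[OF X meas] by (simp add: dens)
qed

lemma (in prob_space) gaussian_combination_tail:
  fixes X :: "'i \<Rightarrow> 'a \<Rightarrow> real"
  assumes I: "finite I" and indep: "indep_vars (\<lambda>_. borel) X I"
    and X: "\<And>i. i \<in> I \<Longrightarrow> distributed M lborel (X i) std_normal_density"
    and v: "(\<Sum>i\<in>I. (a i)\<^sup>2) \<le> v" and "0 < v" "0 < t"
  shows "prob {\<omega> \<in> space M. t \<le> (\<Sum>i\<in>I. a i * X i \<omega>)} \<le> exp (- t\<^sup>2 / (2 * v))"
proof -
  \<comment> \<open>The minimizer of the Chernoff exponent
    \<open>s\<^sup>2 * v / 2 - s * t\<close>.\<close>
  define s where "s = t / v"
  have s: "0 < s" using \<open>0 < v\<close> \<open>0 < t\<close> by (simp add: s_def)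
  have ind: "indep_vars (\<lambda>_. borel) (\<lambda>i \<omega>. exp ((s * a i) * X i \<omega>)) I"
    by (rule indep_vars_compose2[OF indep]) simp
  have prod: "(\<Prod>i\<in>I. exp ((s * a i) * X i \<omega>)) = exp (s * (\<Sum>i\<in>I. a i * X i \<omega>))" for \<omega>
    using I by (simp add: exp_sum sum_distrib_left mult_ac)
  have int: "integrable M (\<lambda>\<omega>. exp (s * (\<Sum>i\<in>I. a i * X i \<omega>)))"
    using indep_vars_integrable[OF I ind] std_normal_mgf(1)[OF X] by (simp add: prod)
  have "expectation (\<lambda>\<omega>. exp (s * (\<Sum>i\<in>I. a i * X i \<omega>))) = (\<Prod>i\<in>I. exp ((s * a i)\<^sup>2 / 2))"
    using indep_vars_lebesgue_integral[OF I ind] std_normal_mgf[OF X] by (simp add: prod)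
  also have "\<dots> = exp (s\<^sup>2 * (\<Sum>i\<in>I. (a i)\<^sup>2) / 2)"
    using I by (simp add: exp_sum sum_distrib_left sum_divide_distrib power_mult_distrib flip: exp_sum)
  also have "\<dots> \<le> exp (s\<^sup>2 * v / 2)"
    using v by (simp add: mult_left_mono)
  finally have mgf: "expectation (\<lambda>\<omega>. exp (s * (\<Sum>i\<in>I. a i * X i \<omega>))) \<le> exp (s\<^sup>2 * v / 2)" .
  have "prob {\<omega> \<in> space M. t \<le> (\<Sum>i\<in>I. a i * X i \<omega>)}
      \<le> exp (- s * t) * (LINT \<omega>:space M|M. exp (s * (\<Sum>i\<in>I. a i * X i \<omega>)))"
    using int unfolding set_integrable_def
    by (intro Chernoff_ineq_ge s, unfold set_integrable_def, intro integrable_mult_indicator) auto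
  also have "(LINT \<omega>:space M|M. exp (s * (\<Sum>i\<in>I. a i * X i \<omega>)))
      = expectation (\<lambda>\<omega>. exp (s * (\<Sum>i\<in>I. a i * X i \<omega>)))"
    using int by (rule set_integral_space)
  also have "exp (- s * t) * \<dots> \<le> exp (- s * t) * exp (s\<^sup>2 * v / 2)"
    using mgf by (intro mult_left_mono) auto
  also have "\<dots> = exp (- t\<^sup>2 / (2 * v))"
    using \<open>0 < v\<close> by (simp add: mult_exp_exp s_def power2_eq_square field_simps)
  finally show ?thesis .
qed

text \<open>Each pair of mirrored positions is collected at its representative above the diagonal.
  Only the entries with \<open>i \<le> j\<close> are independent, so sums over the full square must
  be folded in this way.\<close>

lemma sum_upper_triangle:
  fixes f :: "nat \<Rightarrow> nat \<Rightarrow> 'b :: comm_monoid_add"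
  shows "(\<Sum>(i, j)\<in>{(i, j). i \<le> j \<and> j < n}. if i = j then f i i else f i j + f j i)
    = (\<Sum>i<n. \<Sum>j<n. f i j)"
proof (induction n)
  case 0
  show ?case by simp
next
  case (Suc n)
  have fin: "finite {(i, j). i \<le> j \<and> j < n}"
    by (rule finite_subset[of _ "{..<n} \<times> {..<n}"]) auto
  have split: "{(i, j). i \<le> j \<and> j < Suc n} = {(i, j). i \<le> j \<and> j < n} \<union> (\<lambda>i. (i, n)) ` {..<Suc n}"
    by (auto simp: less_Suc_eq image_iff)
  have "(\<Sum>(i, j)\<in>{(i, j). i \<le> j \<and> j < Suc n}. if i = j then f i i else f i j + f j i)
      = (\<Sum>(i, j)\<in>{(i, j). i \<le> j \<and> j < n}. if i = j then f i i else f i j + f j i)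
        + (\<Sum>(i, j)\<in>(\<lambda>i. (i, n)) ` {..<Suc n}. if i = j then f i i else f i j + f j i)"
    unfolding split using fin by (intro sum.union_disjoint) auto
  also have "(\<Sum>(i, j)\<in>(\<lambda>i. (i, n)) ` {..<Suc n}. if i = j then f i i else f i j + f j i)
      = (\<Sum>i<n. f i n + f n i) + f n n"
    by (subst sum.reindex) (auto simp: inj_on_def)
  finally show ?case
    by (simp add: Suc.IH sum.distrib add_ac)
qed

section \<open>Linear functionals of the GOE matrix in terms of its independent entries\<close>

lemma standard_GOE_entry_symmetric:
  assumes "standard_GOE M n W" "\<omega> \<in> space M" "i < n" "j < n"
  shows "W \<omega> $$ (i, j) = W \<omega> $$ (j, i)"
proof -
  have W: "W \<omega> \<in> carrier_mat n n" "(W \<omega>)\<^sup>T = W \<omega>"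
    using assms by (auto simp: standard_GOE_def)
  have "(W \<omega>)\<^sup>T $$ (i, j) = W \<omega> $$ (j, i)"
    using W(1) assms by simp
  then show ?thesis using W(2) by simp
qed

lemma standard_GOE_sum_conv:
  assumes "standard_GOE M n W" "\<omega> \<in> space M"
  shows "(\<Sum>i<n. \<Sum>j<n. c i j * W \<omega> $$ (i, j)) =
    (\<Sum>p\<in>{(i, j). i \<le> j \<and> j < n}.
      (case p of (i, j) \<Rightarrow> if i = j then c i i else c i j + c j i) * (case p of (i, j) \<Rightarrow> W \<omega> $$ (i, j)))"
  unfolding sum_upper_triangle[symmetric]
proof (intro sum.cong refl)
  fix p assume p: "p \<in> {(i, j). i \<le> j \<and> j < n}"
  obtain i j where ij: "p = (i, j)" "i < n" "j < n" using p by fastforce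
  have "W \<omega> $$ (i, j) = W \<omega> $$ (j, i)"
    using standard_GOE_entry_symmetric[OF assms ij(2,3)] .
  then show "(case p of (i, j) \<Rightarrow> if i = j then c i i * W \<omega> $$ (i, i)
        else c i j * W \<omega> $$ (i, j) + c j i * W \<omega> $$ (j, i))
      = (case p of (i, j) \<Rightarrow> if i = j then c i i else c i j + c j i) * (case p of (i, j) \<Rightarrow> W \<omega> $$ (i, j))"
    by (simp add: ij(1) algebra_simps)
qed

lemma standard_GOE_measurable:
  assumes W: "standard_GOE M n W" and "i < n" "j < n"
  shows "(\<lambda>\<omega>. W \<omega> $$ (i, j)) \<in> borel_measurable M"
proof -
  have upper: "(\<lambda>\<omega>. W \<omega> $$ (i, j)) \<in> borel_measurable M" if "i \<le> j" "j < n" for i j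
  proof -
    have "distributed M lborel (\<lambda>\<omega>. W \<omega> $$ (i, j)) std_normal_density"
      using W that by (simp add: standard_GOE_def)
    then show ?thesis by (auto dest: distributed_measurable)
  qed
  show ?thesis
  proof (cases "i \<le> j")
    case True
    then show ?thesis using upper assms by blast
  next
    case False
    then have "(\<lambda>\<omega>. W \<omega> $$ (j, i)) \<in> borel_measurable M" using upper assms by simp
    then show ?thesis
      using standard_GOE_entry_symmetric[OF W _ assms(2,3)] by (simp cong: measurable_cong)
  qed
qed

text \<open>After folding, the functional is a combination of independent standard normals;
  \<open>v\<close> bounds its variance, in which an off-diagonal entry carries the coefficient
  \<open>c i j + c j i\<close>.\<close>

lemma standard_GOE_combination_tail:
  assumes W: "standard_GOE M n W"
    and v: "(\<Sum>(i, j)\<in>{(i, j). i \<le> j \<and> j < n}. (if i = j then c i i else c i j + c j i)\<^sup>2) \<le> v"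
    and "0 < v" "0 < t"
  shows "measure M {\<omega> \<in> space M. t \<le> (\<Sum>i<n. \<Sum>j<n. c i j * W \<omega> $$ (i, j))} \<le> exp (- t\<^sup>2 / (2 * v))"
proof -
  interpret prob_space M using W by (simp add: standard_GOE_def)
  have fin: "finite {(i, j). i \<le> j \<and> j < n}"
    by (rule finite_subset[of _ "{..<n} \<times> {..<n}"]) auto
  have "prob {\<omega> \<in> space M. t \<le> (\<Sum>p\<in>{(i, j). i \<le> j \<and> j < n}.
      (case p of (i, j) \<Rightarrow> if i = j then c i i else c i j + c j i) * (case p of (i, j) \<Rightarrow> \<lambda>\<omega>. W \<omega> $$ (i, j)) \<omega>)}
      \<le> exp (- t\<^sup>2 / (2 * v))"
  proof (rule gaussian_combination_tail[OF fin])
    show "indep_vars (\<lambda>_. borel) (\<lambda>p. case p of (i, j) \<Rightarrow> \<lambda>\<omega>. W \<omega> $$ (i, j)) {(i, j). i \<le> j \<and> j < n}"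
      using W by (simp add: standard_GOE_def case_prod_unfold)
    show "distributed M lborel (case p of (i, j) \<Rightarrow> \<lambda>\<omega>. W \<omega> $$ (i, j)) std_normal_density"
      if "p \<in> {(i, j). i \<le> j \<and> j < n}" for p
      using W that by (auto simp: standard_GOE_def)
    show "(\<Sum>p\<in>{(i, j). i \<le> j \<and> j < n}. (case p of (i, j) \<Rightarrow> if i = j then c i i else c i j + c j i)\<^sup>2) \<le> v"
      using v by (simp add: case_prod_unfold)
  qed fact+
  then show ?thesis
    using standard_GOE_sum_conv[OF W] by (simp add: case_prod_unfold cong: conj_cong)
qed

section \<open>Quadratic forms of the noise matrix\<close>

text \<open>Two geometric series around 0. The limit 3 is the base of the exponential in
  \<open>card_int_ball\<close>.\<close>

lemma sum_half_powers_int: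
  "(\<Sum>k\<in>{- int m..int m}. (1 / 2) ^ nat \<bar>k\<bar> :: real) = 3 - 2 / 2 ^ m"
proof (induction m)
  case 0
  show ?case by simp
next
  case (Suc m)
  have "{- int (Suc m)..int (Suc m)} = insert (- int (Suc m)) (insert (int (Suc m)) {- int m..int m})"
    by auto
  then have "(\<Sum>k\<in>{- int (Suc m)..int (Suc m)}. (1 / 2) ^ nat \<bar>k\<bar> :: real)
      = 2 * (1 / 2) ^ Suc m + (\<Sum>k\<in>{- int m..int m}. (1 / 2) ^ nat \<bar>k\<bar>)"
    by (simp add: nat_add_distrib)
  then show ?case
    unfolding Suc.IH by (simp add: power_one_over field_simps)
qed

text \<open>The integer points of the ball of squared radius \<open>m\<close>. Extensional functions
  are used so that the set is finite.\<close>

definition int_ball :: "nat \<Rightarrow> nat \<Rightarrow> (nat \<Rightarrow> int) set" where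
  "int_ball n m = {z \<in> {..<n} \<rightarrow>\<^sub>E UNIV. (\<Sum>i<n. (z i)\<^sup>2) \<le> int m}"

lemma abs_le_square_int: "\<bar>k\<bar> \<le> k\<^sup>2" for k :: int
  using self_le_power[of "\<bar>k\<bar>" 2] by (cases "k = 0") auto

lemma int_ball_subset_box: "int_ball n m \<subseteq> {..<n} \<rightarrow>\<^sub>E {- int m..int m}"
proof
  fix z assume z: "z \<in> int_ball n m"
  have "z i \<in> {- int m..int m}" if "i < n" for i
  proof -
    have "\<bar>z i\<bar> \<le> (z i)\<^sup>2"
      by (rule abs_le_square_int)
    also have "\<dots> \<le> (\<Sum>i<n. (z i)\<^sup>2)"
      using that by (intro member_le_sum) auto
    also have "\<dots> \<le> int m"
      using z by (simp add: int_ball_def)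
    finally show ?thesis by auto
  qed
  then show "z \<in> {..<n} \<rightarrow>\<^sub>E {- int m..int m}"
    using z by (auto simp: int_ball_def PiE_iff)
qed

lemma finite_int_ball: "finite (int_ball n m)"
  by (rule finite_subset[OF int_ball_subset_box]) (auto intro: finite_PiE)

text \<open>A point \<open>z\<close> of the ball satisfies
  \<open>(\<Sum>i<n. \<bar>z i\<bar>) \<le> m\<close>, so \<open>2 ^ m\<close> times the product of
  the weights \<open>(1 / 2) ^ nat \<bar>z i\<bar>\<close> is at least 1. Summed over the whole box,
  the weights factor into \<open>n\<close> one-dimensional sums, each at most 3.\<close>

lemma card_int_ball: "real (card (int_ball n m)) \<le> 2 ^ m * 3 ^ n"
proof -
  have "real (card (int_ball n m)) = (\<Sum>z\<in>int_ball n m. 1)"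
    by simp
  also have "\<dots> \<le> (\<Sum>z\<in>int_ball n m. 2 ^ m * (\<Prod>i<n. (1 / 2) ^ nat \<bar>z i\<bar>))"
  proof (rule sum_mono)
    fix z assume z: "z \<in> int_ball n m"
    have "int (\<Sum>i<n. nat \<bar>z i\<bar>) = (\<Sum>i<n. \<bar>z i\<bar>)"
      by simp
    also have "\<dots> \<le> (\<Sum>i<n. (z i)\<^sup>2)"
      by (intro sum_mono abs_le_square_int)
    also have "\<dots> \<le> int m"
      using z by (simp add: int_ball_def)
    finally have "(\<Sum>i<n. nat \<bar>z i\<bar>) \<le> m"
      by (simp only: of_nat_le_iff)
    then have "(1 / 2 :: real) ^ m \<le> (1 / 2) ^ (\<Sum>i<n. nat \<bar>z i\<bar>)"
      by (intro power_decreasing) auto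
    then have "2 ^ m * (1 / 2 :: real) ^ m \<le> 2 ^ m * (\<Prod>i<n. (1 / 2) ^ nat \<bar>z i\<bar>)"
      unfolding power_sum by (intro mult_left_mono) auto
    then show "1 \<le> 2 ^ m * (\<Prod>i<n. (1 / 2 :: real) ^ nat \<bar>z i\<bar>)"
      by (simp add: power_one_over)
  qed
  also have "\<dots> \<le> (\<Sum>z\<in>{..<n} \<rightarrow>\<^sub>E {- int m..int m}. 2 ^ m * (\<Prod>i<n. (1 / 2) ^ nat \<bar>z i\<bar>))"
    by (rule sum_mono2[OF _ int_ball_subset_box]) (simp_all add: finite_PiE prod_nonneg)
  also have "\<dots> = 2 ^ m * (\<Prod>i<n. \<Sum>k\<in>{- int m..int m}. (1 / 2) ^ nat \<bar>k\<bar>)"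
    by (subst prod_sum_PiE) (auto simp: sum_distrib_left)
  also have "\<dots> = 2 ^ m * (3 - 2 / 2 ^ m) ^ n"
    by (simp only: sum_half_powers_int prod_constant card_lessThan)
  also have "\<dots> \<le> 2 ^ m * 3 ^ n"
  proof (intro mult_left_mono power_mono)
    have "2 / 2 ^ m \<le> (2 :: real)" using one_le_power[of "2 :: real" m] by (simp add: field_simps)
    then show "0 \<le> 3 - 2 / (2 :: real) ^ m" by simp
  qed simp_all
  finally show ?thesis .
qed

text \<open>Rounding each coordinate in the direction favoured by the linear functional \<open>l\<close> does not
  decrease it.  Doing so twice replaces a real vector in a quadratic form by two integer vectors,
  so no approximation argument on the sphere is needed.\<close>

lemma ex_int_rounding:
  fixes v :: "nat \<Rightarrow> real"
  assumes v: "(\<Sum>i<n. (v i)\<^sup>2) \<le> real n"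
  shows "\<exists>z\<in>int_ball n (4 * n). (\<Sum>i<n. l i * v i) \<le> (\<Sum>i<n. l i * real_of_int (z i))"
proof -
  define z where "z = (\<lambda>i\<in>{..<n}. if 0 \<le> l i then \<lceil>v i\<rceil> else \<lfloor>v i\<rfloor>)"
  \<comment> \<open>Rounding moves a coordinate by at most 1, and
    \<open>(\<bar>v i\<bar> + 1)\<^sup>2 \<le> 2 * (v i)\<^sup>2 + 2\<close>; summing turns the
    squared norm bound \<open>n\<close> into \<open>4 * n\<close>.\<close>
  have "(real_of_int (z i))\<^sup>2 \<le> 2 * (v i)\<^sup>2 + 2" if "i < n" for i
  proof -
    have "\<bar>real_of_int (z i)\<bar> \<le> \<bar>v i\<bar> + 1"
      using that by (auto simp: z_def) linarith+
    then have "(real_of_int (z i))\<^sup>2 \<le> (\<bar>v i\<bar> + 1)\<^sup>2"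
      by (metis abs_ge_zero power2_abs power_mono)
    also have "\<dots> \<le> 2 * (v i)\<^sup>2 + 2"
      using zero_le_power2[of "\<bar>v i\<bar> - 1"] by (simp add: power2_sum power2_diff)
    finally show ?thesis .
  qed
  then have "(\<Sum>i<n. (real_of_int (z i))\<^sup>2) \<le> (\<Sum>i<n. 2 * (v i)\<^sup>2 + 2)"
    by (intro sum_mono) auto
  also have "\<dots> = 2 * (\<Sum>i<n. (v i)\<^sup>2) + 2 * real n"
    by (simp add: sum.distrib sum_distrib_left)
  also have "\<dots> \<le> 4 * real n" using v by simp
  finally have "real_of_int (\<Sum>i<n. (z i)\<^sup>2) \<le> real_of_int (int (4 * n))"
    by simp
  then have "z \<in> int_ball n (4 * n)"
    unfolding of_int_le_iff by (simp add: int_ball_def z_def)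
  moreover have "(\<Sum>i<n. l i * v i) \<le> (\<Sum>i<n. l i * real_of_int (z i))"
    by (intro sum_mono) (auto simp: z_def intro: mult_left_mono mult_left_mono_neg)
  ultimately show ?thesis by blast
qed

text \<open>By homogeneity \<open>v\<close> may be rescaled to squared norm \<open>n\<close>. The
  form is linear in each argument separately, so the two copies of the vector are rounded one after
  the other; the roundings may differ, which is why the hypothesis ranges over pairs.\<close>

lemma quadratic_form_le_int_ball:
  fixes Q :: "nat \<Rightarrow> nat \<Rightarrow> real"
  assumes t: "\<And>x z. x \<in> int_ball n (4 * n) \<Longrightarrow> z \<in> int_ball n (4 * n) \<Longrightarrow>
      (\<Sum>i<n. \<Sum>j<n. Q i j * (real_of_int (x i) * real_of_int (z j))) \<le> t"
  shows "(\<Sum>i<n. \<Sum>j<n. Q i j * (v i * v j)) \<le> t / real n * (\<Sum>i<n. (v i)\<^sup>2)"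
proof (cases "(\<Sum>i<n. (v i)\<^sup>2) = 0")
  case True
  then have "v i = 0" if "i < n" for i
    using that by (simp add: sum_nonneg_eq_0_iff)
  then show ?thesis by simp
next
  case False
  define S where "S = (\<Sum>i<n. (v i)\<^sup>2)"
  have S: "0 < S" using False sum_nonneg[of "{..<n}" "\<lambda>i. (v i)\<^sup>2"] by (simp add: S_def)
  have n: "0 < real n" using False by (cases n) auto
  define w where "w i = sqrt (real n / S) * v i" for i
  have ww: "w i * w j = real n / S * (v i * v j)" for i j
  proof -
    have "w i * w j = (sqrt (real n / S) * sqrt (real n / S)) * (v i * v j)"
      by (simp only: w_def mult_ac)
    then show ?thesis using S by (simp only: real_sqrt_mult_self) simp
  qed
  have w: "(\<Sum>i<n. (w i)\<^sup>2) \<le> real n"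
    using S by (simp add: power2_eq_square ww flip: sum_distrib_left sum_divide_distrib)
      (simp add: S_def power2_eq_square)
  obtain x where x: "x \<in> int_ball n (4 * n)"
    "(\<Sum>i<n. (\<Sum>j<n. Q i j * w j) * w i) \<le> (\<Sum>i<n. (\<Sum>j<n. Q i j * w j) * real_of_int (x i))"
    using ex_int_rounding[OF w, of "\<lambda>i. \<Sum>j<n. Q i j * w j"] by blast
  obtain z where z: "z \<in> int_ball n (4 * n)"
    "(\<Sum>j<n. (\<Sum>i<n. Q i j * real_of_int (x i)) * w j)
      \<le> (\<Sum>j<n. (\<Sum>i<n. Q i j * real_of_int (x i)) * real_of_int (z j))"
    using ex_int_rounding[OF w, of "\<lambda>j. \<Sum>i<n. Q i j * real_of_int (x i)"] by blast
  have "real n / S * (\<Sum>i<n. \<Sum>j<n. Q i j * (v i * v j)) = (\<Sum>i<n. \<Sum>j<n. Q i j * (w i * w j))"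
    by (simp add: ww sum_distrib_left mult_ac)
  also have "\<dots> = (\<Sum>i<n. (\<Sum>j<n. Q i j * w j) * w i)"
    by (simp add: sum_distrib_left mult_ac)
  also note x(2)
  also have "(\<Sum>i<n. (\<Sum>j<n. Q i j * w j) * real_of_int (x i))
      = (\<Sum>i<n. \<Sum>j<n. Q i j * real_of_int (x i) * w j)"
    by (simp add: sum_distrib_left mult_ac)
  also have "\<dots> = (\<Sum>j<n. (\<Sum>i<n. Q i j * real_of_int (x i)) * w j)"
    by (subst sum.swap) (simp add: sum_distrib_right)
  also note z(2)
  also have "(\<Sum>j<n. (\<Sum>i<n. Q i j * real_of_int (x i)) * real_of_int (z j))
      = (\<Sum>j<n. \<Sum>i<n. Q i j * (real_of_int (x i) * real_of_int (z j)))"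
    by (simp add: sum_distrib_left mult_ac)
  also have "\<dots> = (\<Sum>i<n. \<Sum>j<n. Q i j * (real_of_int (x i) * real_of_int (z j)))"
    by (rule sum.swap)
  also have "\<dots> \<le> t" using t x(1) z(1) by blast
  finally show ?thesis
    using S n by (simp add: S_def field_simps)
qed

text \<open>The folded coefficients \<open>a i * b j + a j * b i\<close> have squares summing to at
  most twice the product of the two squared norms, that is
  \<open>2 * (4 * n)\<^sup>2 = 32 * n\<^sup>2\<close>.\<close>

lemma standard_GOE_int_form_tail:
  assumes W: "standard_GOE M n W" and n: "0 < n" and t: "0 < t"
    and x: "x \<in> int_ball n (4 * n)" and z: "z \<in> int_ball n (4 * n)"
  shows "measure M {\<omega> \<in> space M. t \<le>
      (\<Sum>i<n. \<Sum>j<n. real_of_int (x i) * real_of_int (z j) * W \<omega> $$ (i, j))}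
    \<le> exp (- t\<^sup>2 / (64 * (real n)\<^sup>2))"
proof -
  define a b where "a i = real_of_int (x i)" and "b i = real_of_int (z i)" for i
  have a: "(\<Sum>i<n. (a i)\<^sup>2) \<le> 4 * real n" and b: "(\<Sum>i<n. (b i)\<^sup>2) \<le> 4 * real n"
  proof -
    have "real_of_int (\<Sum>i<n. (x i)\<^sup>2) \<le> real_of_int (int (4 * n))"
      "real_of_int (\<Sum>i<n. (z i)\<^sup>2) \<le> real_of_int (int (4 * n))"
      unfolding of_int_le_iff using x z by (simp_all add: int_ball_def)
    then show "(\<Sum>i<n. (a i)\<^sup>2) \<le> 4 * real n" "(\<Sum>i<n. (b i)\<^sup>2) \<le> 4 * real n"
      by (simp_all add: a_def b_def)
  qed
  have "(\<Sum>(i, j)\<in>{(i, j). i \<le> j \<and> j < n}. (if i = j then a i * b i else a i * b j + a j * b i)\<^sup>2)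
      \<le> (\<Sum>(i, j)\<in>{(i, j). i \<le> j \<and> j < n}. if i = j then 2 * (a i)\<^sup>2 * (b i)\<^sup>2
          else 2 * (a i)\<^sup>2 * (b j)\<^sup>2 + 2 * (a j)\<^sup>2 * (b i)\<^sup>2)"
  proof (rule sum_mono, clarify)
    fix i j
    show "(if i = j then a i * b i else a i * b j + a j * b i)\<^sup>2
      \<le> (if i = j then 2 * (a i)\<^sup>2 * (b i)\<^sup>2 else 2 * (a i)\<^sup>2 * (b j)\<^sup>2 + 2 * (a j)\<^sup>2 * (b i)\<^sup>2)"
      using zero_le_power2[of "a i * b j - a j * b i"]
      by (simp add: power2_sum power2_diff power_mult_distrib)
  qed
  also have "\<dots> = (\<Sum>i<n. \<Sum>j<n. 2 * (a i)\<^sup>2 * (b j)\<^sup>2)"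
    by (rule sum_upper_triangle)
  also have "\<dots> = (\<Sum>i<n. 2 * (a i)\<^sup>2 * (\<Sum>j<n. (b j)\<^sup>2))"
    by (simp only: sum_distrib_left)
  also have "\<dots> = 2 * ((\<Sum>i<n. (a i)\<^sup>2) * (\<Sum>i<n. (b i)\<^sup>2))"
    by (simp only: sum_distrib_right[symmetric] sum_distrib_left[symmetric] mult.assoc)
  also have "\<dots> \<le> 2 * ((4 * real n) * (4 * real n))"
    using a b by (intro mult_left_mono mult_mono sum_nonneg) auto
  finally have "measure M {\<omega> \<in> space M. t \<le> (\<Sum>i<n. \<Sum>j<n. a i * b j * W \<omega> $$ (i, j))}
      \<le> exp (- t\<^sup>2 / (2 * (32 * (real n)\<^sup>2)))"
    using n t by (intro standard_GOE_combination_tail[OF W]) (auto simp: power2_eq_square)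
  then show ?thesis by (simp add: a_def b_def)
qed

lemma standard_GOE_row_sum_tail:
  assumes W: "standard_GOE M n W" and k: "k < n" and t: "0 < t"
  shows "measure M {\<omega> \<in> space M. t \<le> - (\<Sum>j<n. W \<omega> $$ (k, j))} \<le> exp (- t\<^sup>2 / (2 * real n))"
proof -
  define c :: "nat \<Rightarrow> nat \<Rightarrow> real" where "c i j = (if i = k then - 1 else 0)" for i j
  have c_sum: "(\<Sum>i<n. \<Sum>j<n. c i j * f i j) = - (\<Sum>j<n. f k j)" for f
  proof -
    have "(\<Sum>i<n. \<Sum>j<n. c i j * f i j) = (\<Sum>i<n. if i = k then - (\<Sum>j<n. f i j) else 0)"
      by (intro sum.cong refl) (auto simp: c_def sum_negf)
    then show ?thesis using k by simp
  qed
  \<comment> \<open>Off the diagonal at most one of \<open>c i j\<close> and \<open>c j i\<close> is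
    nonzero, so the cross terms vanish and the variance is exactly \<open>n\<close>. This sharp
    value produces the threshold constant.\<close>
  have "(\<Sum>(i, j)\<in>{(i, j). i \<le> j \<and> j < n}. (if i = j then c i i else c i j + c j i)\<^sup>2)
      = (\<Sum>(i, j)\<in>{(i, j). i \<le> j \<and> j < n}. if i = j then c i i * c i i else c i j * c i j + c j i * c j i)"
    by (intro sum.cong refl) (auto simp: c_def)
  also have "\<dots> = (\<Sum>i<n. \<Sum>j<n. c i j * c i j)"
    by (rule sum_upper_triangle)
  also have "\<dots> = real n"
    unfolding c_sum by (simp add: c_def)
  finally have "measure M {\<omega> \<in> space M. t \<le> (\<Sum>i<n. \<Sum>j<n. c i j * W \<omega> $$ (i, j))}
      \<le> exp (- t\<^sup>2 / (2 * real n))"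
    using k t by (intro standard_GOE_combination_tail[OF W]) auto
  then show ?thesis by (simp add: c_sum)
qed

text \<open>Union bound over the \<open>n\<close> rows and over all pairs of integer points. The
  explicit finite union \<open>B\<close> is measurable, while the bound for all real
  \<open>v\<close> holds pointwise outside it.\<close>

lemma standard_GOE_exceptional_event:
  assumes W: "standard_GOE M n W" and n: "0 < n" and a: "0 < a" and t: "0 < t"
  obtains B where "B \<in> sets M"
    and "measure M B \<le> real n * exp (- a\<^sup>2 / (2 * real n)) + 2304 ^ n * exp (- t\<^sup>2 / (64 * (real n)\<^sup>2))"
    and "\<And>\<omega> k. \<omega> \<in> space M - B \<Longrightarrow> k < n \<Longrightarrow> - a \<le> (\<Sum>j<n. W \<omega> $$ (k, j))"
    and "\<And>\<omega> v. \<omega> \<in> space M - B \<Longrightarrow>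
      (\<Sum>i<n. \<Sum>j<n. W \<omega> $$ (i, j) * (v i * v j)) \<le> t / real n * (\<Sum>i<n. (v i)\<^sup>2)"
proof -
  interpret prob_space M using W by (simp add: standard_GOE_def)
  note meas = standard_GOE_measurable[OF W]
  let ?N = "int_ball n (4 * n)"
  define R where "R k = {\<omega> \<in> space M. a \<le> - (\<Sum>j<n. W \<omega> $$ (k, j))}" for k
  define F where "F p = {\<omega> \<in> space M. t \<le>
      (\<Sum>i<n. \<Sum>j<n. real_of_int (fst p i) * real_of_int (snd p j) * W \<omega> $$ (i, j))}" for p
  have R: "R k \<in> events" if "k < n" for k
    unfolding R_def using meas that
    by (intro borel_measurable_le borel_measurable_uminus borel_measurable_sum) auto
  have F: "F p \<in> events" for p
    unfolding F_def using meas
    by (intro borel_measurable_le borel_measurable_times borel_measurable_sum) auto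
  define B where "B = (\<Union>k<n. R k) \<union> (\<Union>p\<in>?N \<times> ?N. F p)"
  have B: "B \<in> events"
    unfolding B_def using R F finite_int_ball
    by (intro sets.Un sets.finite_UN finite_cartesian_product) auto
  have "prob B \<le> prob (\<Union>k<n. R k) + prob (\<Union>p\<in>?N \<times> ?N. F p)"
    unfolding B_def using R F finite_int_ball
    by (intro measure_subadditive sets.finite_UN finite_cartesian_product) auto
  also have "prob (\<Union>k<n. R k) \<le> (\<Sum>k<n. prob (R k))"
    using R by (intro finite_measure_subadditive_finite) auto
  also have "\<dots> \<le> (\<Sum>k<n. exp (- a\<^sup>2 / (2 * real n)))"
    unfolding R_def using standard_GOE_row_sum_tail[OF W _ a] by (intro sum_mono) auto
  also have "prob (\<Union>p\<in>?N \<times> ?N. F p) \<le> (\<Sum>p\<in>?N \<times> ?N. prob (F p))"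
    using F finite_int_ball by (intro finite_measure_subadditive_finite finite_cartesian_product) auto
  also have "\<dots> \<le> (\<Sum>p\<in>?N \<times> ?N. exp (- t\<^sup>2 / (64 * (real n)\<^sup>2)))"
    unfolding F_def using standard_GOE_int_form_tail[OF W n t] by (intro sum_mono) auto
  also have "\<dots> = real (card ?N) * real (card ?N) * exp (- t\<^sup>2 / (64 * (real n)\<^sup>2))"
    by (simp add: card_cartesian_product)
  also have "\<dots> \<le> 2304 ^ n * exp (- t\<^sup>2 / (64 * (real n)\<^sup>2))"
  proof -
    \<comment> \<open>Here \<open>48 = 2 ^ 4 * 3\<close>, and pairs of points give
      \<open>2304 = 48\<^sup>2\<close>.\<close>
    have c: "real (card ?N) \<le> 48 ^ n"
      using card_int_ball[of n "4 * n"] by (simp add: power_mult flip: power_mult_distrib)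
    have "real (card ?N) * real (card ?N) \<le> 48 ^ n * 48 ^ n"
      using c by (intro mult_mono) auto
    then show ?thesis by (intro mult_right_mono) (auto simp flip: power_mult_distrib)
  qed
  finally have prob_B: "prob B \<le> real n * exp (- a\<^sup>2 / (2 * real n))
      + 2304 ^ n * exp (- t\<^sup>2 / (64 * (real n)\<^sup>2))"
    by simp
  have row: "- a \<le> (\<Sum>j<n. W \<omega> $$ (k, j))" if "\<omega> \<in> space M - B" "k < n" for \<omega> k
  proof -
    have "\<omega> \<notin> R k" using that by (auto simp: B_def)
    then have "- (\<Sum>j<n. W \<omega> $$ (k, j)) < a" using that(1) by (simp add: R_def)
    then show ?thesis by linarith
  qed
  have quad: "(\<Sum>i<n. \<Sum>j<n. W \<omega> $$ (i, j) * (v i * v j)) \<le> t / real n * (\<Sum>i<n. (v i)\<^sup>2)"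
    if \<omega>: "\<omega> \<in> space M - B" for \<omega> v
  proof (rule quadratic_form_le_int_ball)
    fix x z assume xz: "x \<in> ?N" "z \<in> ?N"
    then have "\<omega> \<notin> F (x, z)" using \<omega> by (auto simp: B_def)
    then show "(\<Sum>i<n. \<Sum>j<n. W \<omega> $$ (i, j) * (real_of_int (x i) * real_of_int (z j))) \<le> t"
      using \<omega> by (simp add: F_def mult_ac)
  qed
  show thesis by (rule that[OF B prob_B row quad])
qed

text \<open>The form depends only on differences, so \<open>v\<close> may be centered. The constant
  weights then contribute \<open>2 * real n * S\<close>, and the weights \<open>Q\<close> contribute
  twice the diagonal form of the row sums minus twice the form of \<open>Q\<close>.\<close>

lemma laplacian_form_pos:
  fixes Q :: "nat \<Rightarrow> nat \<Rightarrow> real"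
  assumes sym: "\<And>i j. i < n \<Longrightarrow> j < n \<Longrightarrow> Q i j = Q j i"
    and row: "\<And>i. i < n \<Longrightarrow> - a \<le> (\<Sum>j<n. Q i j)"
    and quad: "\<And>v. (\<Sum>i<n. \<Sum>j<n. Q i j * (v i * v j)) \<le> b * (\<Sum>i<n. (v i)\<^sup>2)"
    and \<sigma>: "0 < \<sigma>" and gap: "\<sigma> * (a + b) < real n"
    and k: "k < n" "l < n" "v k \<noteq> v l"
  shows "0 < (\<Sum>i<n. \<Sum>j<n. (1 + \<sigma> * Q i j) * (v i - v j)\<^sup>2)"
proof -
  have n: "real n \<noteq> 0" using k by simp
  define m where "m = (\<Sum>i<n. v i) / real n"
  define w where "w i = v i - m" for i
  have w0: "(\<Sum>i<n. w i) = 0"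
    using n by (simp add: w_def sum_subtractf m_def)
  define S where "S = (\<Sum>i<n. (w i)\<^sup>2)"
  have "w k \<noteq> 0 \<or> w l \<noteq> 0" using k by (auto simp: w_def)
  then have S: "0 < S"
    unfolding S_def using k sum_pos2[of "{..<n}" k "\<lambda>i. (w i)\<^sup>2"] sum_pos2[of "{..<n}" l "\<lambda>i. (w i)\<^sup>2"]
    by auto
  have "(\<Sum>i<n. \<Sum>j<n. (w i - w j)\<^sup>2) = (\<Sum>i<n. real n * (w i)\<^sup>2 + S - 2 * w i * (\<Sum>j<n. w j))"
    by (simp add: power2_diff sum_subtractf sum.distrib S_def sum_distrib_left mult_ac)
  also have "\<dots> = 2 * real n * S"
    by (simp add: w0 sum.distrib S_def flip: sum_distrib_left)
  finally have flat: "(\<Sum>i<n. \<Sum>j<n. (w i - w j)\<^sup>2) = 2 * real n * S" .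
  have swap: "(\<Sum>i<n. \<Sum>j<n. Q i j * (w j)\<^sup>2) = (\<Sum>i<n. \<Sum>j<n. Q i j * (w i)\<^sup>2)"
    by (subst sum.swap, intro sum.cong refl) (simp add: sym)
  have "(\<Sum>i<n. \<Sum>j<n. Q i j * (w i - w j)\<^sup>2)
      = (\<Sum>i<n. \<Sum>j<n. Q i j * (w i)\<^sup>2) + (\<Sum>i<n. \<Sum>j<n. Q i j * (w j)\<^sup>2)
        - 2 * (\<Sum>i<n. \<Sum>j<n. Q i j * (w i * w j))"
    unfolding sum_distrib_left sum.distrib[symmetric] sum_subtractf[symmetric]
    by (intro sum.cong refl) (simp add: power2_diff algebra_simps)
  also have "\<dots> = 2 * (\<Sum>i<n. (\<Sum>j<n. Q i j) * (w i)\<^sup>2) - 2 * (\<Sum>i<n. \<Sum>j<n. Q i j * (w i * w j))"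
    unfolding swap by (simp add: sum_distrib_right)
  also have "\<dots> \<ge> 2 * (- a * S) - 2 * (b * S)"
  proof -
    have "- a * S \<le> (\<Sum>i<n. (\<Sum>j<n. Q i j) * (w i)\<^sup>2)"
      unfolding S_def sum_distrib_left using row by (intro sum_mono mult_right_mono) auto
    then show ?thesis using quad[of w] by (simp add: S_def)
  qed
  finally have "\<sigma> * (2 * (- a * S) - 2 * (b * S)) \<le> \<sigma> * (\<Sum>i<n. \<Sum>j<n. Q i j * (w i - w j)\<^sup>2)"
    using \<sigma> by (intro mult_left_mono) auto
  moreover have "(\<Sum>i<n. \<Sum>j<n. (1 + \<sigma> * Q i j) * (v i - v j)\<^sup>2)
      = (\<Sum>i<n. \<Sum>j<n. (w i - w j)\<^sup>2) + \<sigma> * (\<Sum>i<n. \<Sum>j<n. Q i j * (w i - w j)\<^sup>2)"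
    unfolding sum_distrib_left sum.distrib[symmetric]
    by (intro sum.cong refl) (simp add: w_def algebra_simps)
  moreover have "0 < 2 * ((real n - \<sigma> * (a + b)) * S)"
    using gap S by simp
  ultimately show ?thesis
    unfolding flat by (simp add: algebra_simps)
qed

section \<open>Exact recovery below the threshold\<close>

lemma recovery_prob_ge:
  assumes W: "standard_GOE M n W" and n: "0 < n" and a: "0 < a" and \<sigma>: "0 < \<sigma>"
    and y: "\<And>i. i < n \<Longrightarrow> norm (y i) = 1"
    and gap: "\<sigma> * (a + 32 * sqrt (real n)) < real n"
  shows "1 - (real n * exp (- a\<^sup>2 / (2 * real n)) + (1 / 2) ^ n) \<le> recovery_prob M n y \<sigma> W"
proof -
  interpret prob_space M using W by (simp add: standard_GOE_def)
  \<comment> \<open>This choice makes the exponent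
    \<open>t\<^sup>2 / (64 * (real n)\<^sup>2)\<close> equal to \<open>16 * real n\<close>, enough
    to beat the \<open>2304 ^ n\<close> pairs, while \<open>t / real n\<close> is only of order
    \<open>sqrt (real n)\<close>.\<close>
  define t where "t = 32 * real n * sqrt (real n)"
  have t: "0 < t" and t_n: "t / real n = 32 * sqrt (real n)"
    using n by (simp_all add: t_def)
  have "t\<^sup>2 = 1024 * (real n)\<^sup>2 * real n"
    by (simp add: t_def power_mult_distrib)
  then have t2: "- t\<^sup>2 / (64 * (real n)\<^sup>2) = - (16 * real n)"
    using n by (simp add: field_simps power2_eq_square)
  have "2304 * exp (- 16 :: real) \<le> 1 / 2"
  proof -
    have "(2 :: real) ^ 16 \<le> exp 1 ^ 16"
      using exp_ge_add_one_self[of 1] by (intro power_mono) auto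
    also have "\<dots> = exp 16" by (simp flip: exp_of_nat_mult)
    finally show ?thesis by (simp add: exp_minus field_simps)
  qed
  then have "(2304 * exp (- 16 :: real)) ^ n \<le> (1 / 2) ^ n"
    by (intro power_mono) auto
  then have net: "2304 ^ n * exp (- t\<^sup>2 / (64 * (real n)\<^sup>2)) \<le> (1 / 2) ^ n"
    unfolding t2 by (simp add: power_mult_distrib mult.commute flip: exp_of_nat_mult)
  obtain B where B: "B \<in> events"
    "prob B \<le> real n * exp (- a\<^sup>2 / (2 * real n)) + 2304 ^ n * exp (- t\<^sup>2 / (64 * (real n)\<^sup>2))"
    and row: "\<And>\<omega> k. \<omega> \<in> space M - B \<Longrightarrow> k < n \<Longrightarrow> - a \<le> (\<Sum>j<n. W \<omega> $$ (k, j))"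
    and quad: "\<And>\<omega> v. \<omega> \<in> space M - B \<Longrightarrow>
      (\<Sum>i<n. \<Sum>j<n. W \<omega> $$ (i, j) * (v i * v j)) \<le> t / real n * (\<Sum>i<n. (v i)\<^sup>2)"
    using standard_GOE_exceptional_event[OF W n a t] by blast
  define R where "R = {\<omega> \<in> space M. sdp_solutions n (observation n y \<sigma> (W \<omega>)) = {self_outer n y}}"
  have carrier: "W \<omega> \<in> carrier_mat n n" if "\<omega> \<in> space M" for \<omega>
    using W that by (simp add: standard_GOE_def)
  \<comment> \<open>A non-measurable set has \<open>measure\<close> 0 by convention, so the
    inclusion below bounds the probability only because \<open>R\<close> is an event.\<close>
  have R: "R \<in> events"
    unfolding R_def using y carrier standard_GOE_measurable[OF W] by (rule sets_recovery)
  have "space M - B \<subseteq> R"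
  proof
    fix \<omega> assume \<omega>: "\<omega> \<in> space M - B"
    have "sdp_solutions n (observation n y \<sigma> (W \<omega>)) = {self_outer n y}"
    proof (rule sdp_solutions_observation[OF y])
      show "W \<omega> \<in> carrier_mat n n" using carrier \<omega> by simp
      fix v :: "nat \<Rightarrow> real" and k l assume "k < n" "l < n" "v k \<noteq> v l"
      then show "0 < (\<Sum>i<n. \<Sum>j<n. (1 + \<sigma> * W \<omega> $$ (i, j)) * (v i - v j)\<^sup>2)"
        using \<omega> \<sigma> gap row quad standard_GOE_entry_symmetric[OF W]
        by (intro laplacian_form_pos[where a = a and b = "t / real n"]) (auto simp: t_n)
    qed simp_all
    then show "\<omega> \<in> R" using \<omega> by (simp add: R_def)
  qed
  then have "1 - prob B \<le> prob R"
    using finite_measure_mono[OF _ R] unfolding prob_compl[OF B(1), symmetric] by blast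
  then show ?thesis
    using B(2) net by (simp add: recovery_prob_def R_def)
qed

theorem theorem2p5:
  fixes k :: nat and d :: "nat \<Rightarrow> real"
    and y :: "nat \<Rightarrow> nat \<Rightarrow> complex"
    and \<sigma> :: "nat \<Rightarrow> real" and \<delta> :: real
    and M :: "nat \<Rightarrow> 'a measure" and W :: "nat \<Rightarrow> 'a \<Rightarrow> real mat"
  assumes "2 \<le> k"
    and "inj_on d {1..k}"
    and "\<And>j. j \<in> {1..k} \<Longrightarrow> d j \<in> {0..<2 * pi}"
    and "\<And>n i. i < n \<Longrightarrow> y n i \<in> (\<lambda>j. exp (\<i> * complex_of_real (d j))) ` {1..k}"
    and "\<And>n. standard_GOE (M n) n (W n)"
    and "\<And>n. 0 < \<sigma> n"
    and "0 < \<delta>"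
    and "\<And>n. 2 \<le> n \<Longrightarrow> \<sigma> n < (1 - \<delta>) * sqrt (real n) / sqrt (2 * ln (real n))"
  shows "(\<lambda>n. recovery_prob (M n) n (y n) (\<sigma> n) (W n)) \<longlonglongrightarrow> 1"
proof (rule real_tendsto_sandwich)
  have y: "norm (y n i) = 1" if "i < n" for n i
    using assms(4)[OF that] by auto
  \<comment> \<open>Otherwise the upper bound on \<open>\<sigma> 2\<close> would be
    nonpositive.\<close>
  have \<delta>1: "\<delta> < 1"
  proof (rule ccontr)
    assume "\<not> \<delta> < 1"
    then have "(1 - \<delta>) * sqrt (real 2) / sqrt (2 * ln (real 2)) \<le> 0"
      by (intro divide_nonpos_nonneg mult_nonpos_nonneg) auto
    then show False using assms(6)[of 2] assms(8)[of 2] by simp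
  qed
  \<comment> \<open>The extra factor \<open>1 + \<delta>\<close> under the root makes the union
    bound over \<open>n\<close> rows equal to \<open>n\<close> to the power
    \<open>- \<delta>\<close>, the first term of \<open>e n\<close>.\<close>
  define a where "a n = sqrt (2 * (1 + \<delta>) * real n * ln (real n))" for n
  define e where "e n = exp (- \<delta> * ln (real n)) + (1 / 2) ^ n" for n
  \<comment> \<open>The loss from enlarging \<open>a n\<close> is covered by the margin
    \<open>1 - \<delta>\<close>, leaving the fraction \<open>\<delta> / 2\<close> of
    \<open>n\<close> for the quadratic form term.\<close>
  have root: "(1 - \<delta>) * sqrt (1 + \<delta>) \<le> 1 - \<delta> / 2"
  proof -
    have "sqrt (1 + \<delta>) \<le> 1 + \<delta> / 2"
      using \<open>0 < \<delta>\<close> by (intro real_le_lsqrt) (auto simp: power2_sum field_simps power2_eq_square)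
    then have "(1 - \<delta>) * sqrt (1 + \<delta>) \<le> (1 - \<delta>) * (1 + \<delta> / 2)"
      using \<delta>1 by (intro mult_left_mono) auto
    also have "\<dots> \<le> 1 - \<delta> / 2"
      by (simp add: algebra_simps)
    finally show ?thesis .
  qed
  \<comment> \<open>For such \<open>n\<close> the term \<open>32 * sqrt (real n)\<close> takes up at
    most that remaining fraction, since \<open>32 / s \<le> \<delta> / 2\<close>.\<close>
  have "\<forall>\<^sub>F n in sequentially. 64 / \<delta> \<le> sqrt (2 * ln (real n))"
    by real_asymp
  then have "\<forall>\<^sub>F n in sequentially. 1 - e n \<le> recovery_prob (M n) n (y n) (\<sigma> n) (W n)"
    using eventually_ge_at_top[of 2]
  proof eventually_elim
    case (elim n)
    define s where "s = sqrt (2 * ln (real n))"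
    have ln: "0 < ln (real n)" and n: "0 < real n" using elim by auto
    have s: "0 < s" "64 / \<delta> \<le> s" using ln elim by (simp_all add: s_def)
    have a: "a n = sqrt (1 + \<delta>) * sqrt (real n) * s"
      by (simp add: a_def s_def mult_ac flip: real_sqrt_mult)
    have a_pos: "0 < a n" using ln n \<open>0 < \<delta>\<close> by (simp add: a_def)
    have "\<sigma> n * (a n + 32 * sqrt (real n))
        < (1 - \<delta>) * sqrt (real n) / s * (a n + 32 * sqrt (real n))"
      using assms(8)[of n] elim a_pos
      by (intro mult_strict_right_mono add_pos_nonneg) (auto simp: s_def)
    also have "\<dots> = (1 - \<delta>) * sqrt (1 + \<delta>) * real n + (1 - \<delta>) * (32 / s) * real n"
    proof -
      have "(1 - \<delta>) * r / s * (sqrt (1 + \<delta>) * r * s + 32 * r)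
          = (1 - \<delta>) * sqrt (1 + \<delta>) * (r * r) + (1 - \<delta>) * (32 / s) * (r * r)" for r
        using s(1) by (simp add: field_simps)
      from this[of "sqrt (real n)"] show ?thesis
        unfolding a by simp
    qed
    also have "\<dots> \<le> (1 - \<delta> / 2) * real n + \<delta> / 2 * real n"
    proof (intro add_mono mult_right_mono root)
      have "(1 - \<delta>) * (32 / s) \<le> 1 * (32 / s)"
        using s(1) \<open>0 < \<delta>\<close> by (intro mult_right_mono) auto
      also have "\<dots> \<le> \<delta> / 2"
        using s \<open>0 < \<delta>\<close> by (simp add: field_simps)
      finally show "(1 - \<delta>) * (32 / s) \<le> \<delta> / 2" .
    qed simp_all
    finally have gap: "\<sigma> n * (a n + 32 * sqrt (real n)) < real n"
      by (simp add: algebra_simps)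
    have "(a n)\<^sup>2 = 2 * (1 + \<delta>) * real n * ln (real n)"
      using ln \<open>0 < \<delta>\<close> by (simp add: a_def)
    then have "- (a n)\<^sup>2 / (2 * real n) = - ln (real n) + - \<delta> * ln (real n)"
      using n by (simp add: field_simps)
    then have "real n * exp (- (a n)\<^sup>2 / (2 * real n)) = exp (- \<delta> * ln (real n))"
      using n by (simp only: exp_add) (simp add: exp_minus)
    then show ?case
      using recovery_prob_ge[OF assms(5) _ a_pos assms(6) y gap] n by (simp add: e_def)
  qed
  then show "\<forall>\<^sub>F n in sequentially. 1 - e n \<le> recovery_prob (M n) n (y n) (\<sigma> n) (W n)" .
  show "\<forall>\<^sub>F n in sequentially. recovery_prob (M n) n (y n) (\<sigma> n) (W n) \<le> 1"
    using assms(5) by (simp add: recovery_prob_def standard_GOE_def prob_space.prob_le_1)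
  show "(\<lambda>n. 1 - e n) \<longlonglongrightarrow> 1"
    unfolding e_def using \<open>0 < \<delta>\<close> by real_asymp
qed simp_all

end
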